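(* Work in the theory $\mathrm{EST}+\mathrm{VP}$. Then the class $\omega=\{x:\mathrm{Nat}(x)\}$ is a set. Consequently $\mathrm{EST}+\mathrm{VP}$ proves the Axiom of Infinity.
   Context: All theories are in the language $\{\in\}$. EST is the theory with the axioms: Extensionality, Empty Set, Pairing, Union, Cartesian Product (for all sets $x,y$, $x\times y$ is a set), $\Delta_0$-Separation, and the Induction scheme along $\omega$ described below. Define $\mathrm{Ord}(x)$: $x$ is transitive and $(\forall y,z\in x)(y\in z\vee y=z\vee z\in y)$; $\mathrm{Succ}(x)$: $(\exists y\in x)(x=y\cup\{y\})$; $\mathrm{Nat}(x)$: $\mathrm{Ord}(x)\wedge(\forall y)[(y\in x\vee y=x)\to(y=\emptyset\vee \mathrm{Succ}(y))]$; $\omega=\{x:\mathrm{Nat}(x)\}$ (a class, not assumed to be a set). The Induction scheme: for every formula $\phi(x)$ with $(\forall x)(\phi(x)\to \mathrm{Nat}(x))$: $[\phi(\emptyset)\wedge(\forall x\in\omega)(\phi(x)\to\phi(x\cup\{x\}))]\to(\forall x\in\omega)\phi(x)$. For a formula $\phi(x)$, $X_\phi=\{x:\phi(x)\}$; "$X_\phi$ is a proper class" means $(\forall x)(\exists y)[(\phi(y)\wedge y\notin x)\vee(\neg\phi(y)\wedge y\in x)]$. For a set $A$, $L_A$ is the first-order language with equality, a unary predicate $\mathbf U$, a binary predicate $\mathbf R$ (either may be omitted) and a constant $\mathbf c_a$ for each $a\in A$ (formulas are coded as sets in the standard way: variables $v_n=\langle 0,n\rangle$, constants $\mathbf c_a=\langle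 1,a\rangle$, with formulas built by finite formation sequences). An $L_A$-structure is a quadruple $\langle M,U,R,I\rangle$ with $U\subseteq M$, $R\subseteq M\times M$, $I:A\to M$ a function interpreting $\mathbf c_a$ as $I(a)$; satisfaction is defined in the usual Tarskian way (definable in EST), and an elementary embedding is an injective map preserving satisfaction of all $L_A$-formulas. VP (Vopěnka's Principle) is the scheme: for every formula $\phi(x)$ of $\{\in\}$ and every set $A$, if $X_\phi$ is a proper class of $L_A$-structures, then there are distinct $\mathcal M,\mathcal N\in X_\phi$ and an elementary embedding $f:\mathcal M\to\mathcal N$. *)

theory Defs
  imports Main
begin

section \<open>First-order logic with equality in the language of set theory\<close>

text \<open>Formulas with de Bruijn indices: \<open>All\<close> binds index \<open>0\<close>. The language has no function
  symbols, so substitution of terms for variables is renaming of variables.\<close>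

datatype fm = Bot | Mem nat nat | Eq nat nat | Imp fm fm | All fm

abbreviation Neg :: "fm \<Rightarrow> fm" where
  "Neg p \<equiv> Imp p Bot"

primrec lift :: "(nat \<Rightarrow> nat) \<Rightarrow> nat \<Rightarrow> nat" where
  "lift r 0 = 0"
| "lift r (Suc i) = Suc (r i)"

primrec ren :: "(nat \<Rightarrow> nat) \<Rightarrow> fm \<Rightarrow> fm" where
  "ren r Bot = Bot"
| "ren r (Mem i j) = Mem (r i) (r j)"
| "ren r (Eq i j) = Eq (r i) (r j)"
| "ren r (Imp p q) = Imp (ren r p) (ren r q)"
| "ren r (All p) = All (ren (lift r) p)"

definition inst :: "nat \<Rightarrow> fm \<Rightarrow> fm" where
  "inst t p = ren (case_nat t (\<lambda>i. i)) p"

primrec fv :: "fm \<Rightarrow> nat set" where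
  "fv Bot = {}"
| "fv (Mem i j) = {i, j}"
| "fv (Eq i j) = {i, j}"
| "fv (Imp p q) = fv p \<union> fv q"
| "fv (All p) = {i. Suc i \<in> fv p}"

text \<open>Classical natural deduction with equality.\<close>

inductive derives :: "fm set \<Rightarrow> fm \<Rightarrow> bool" (infix "\<turnstile>" 45) where
  Assm: "p \<in> G \<Longrightarrow> G \<turnstile> p"
| ImpI: "insert p G \<turnstile> q \<Longrightarrow> G \<turnstile> Imp p q"
| ImpE: "G \<turnstile> Imp p q \<Longrightarrow> G \<turnstile> p \<Longrightarrow> G \<turnstile> q"
| Contr: "insert (Neg p) G \<turnstile> Bot \<Longrightarrow> G \<turnstile> p"
| AllI: "ren Suc ` G \<turnstile> p \<Longrightarrow> G \<turnstile> All p"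
| AllE: "G \<turnstile> All p \<Longrightarrow> G \<turnstile> inst t p"
| EqI: "G \<turnstile> Eq t t"
| EqE: "G \<turnstile> Eq t u \<Longrightarrow> G \<turnstile> inst t p \<Longrightarrow> G \<turnstile> inst u p"

text \<open>Bounded existential quantifiers are covered through \<open>\<not>\<forall>\<not>\<close>.\<close>

inductive Delta0 :: "fm \<Rightarrow> bool" where
  "Delta0 Bot"
| "Delta0 (Mem i j)"
| "Delta0 (Eq i j)"
| "Delta0 p \<Longrightarrow> Delta0 q \<Longrightarrow> Delta0 (Imp p q)"
| "Delta0 p \<Longrightarrow> Delta0 (All (Imp (Mem 0 (Suc j)) p))"


section \<open>Writing formulas with bound variable names\<close>

text \<open>To keep concrete formulas readable they are written with de Bruijn levels. An \<open>lfm\<close> yields a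
  formula once the number \<open>n\<close> of enclosing quantifiers is given; the variable bound by the
  quantifier at depth \<open>x\<close> is denoted by the number \<open>x\<close>, i.e. it is the index \<open>n - Suc x\<close> at
  depth \<open>n\<close>. A quantifier hands its own level to its body, so HOL-bound variables act as the
  names of object-level variables. A closed \<open>F\<close> denotes the sentence \<open>F 0\<close>.\<close>

type_synonym lfm = "nat \<Rightarrow> fm"

definition memL :: "nat \<Rightarrow> nat \<Rightarrow> lfm" (infix "\<^bold>\<in>" 50) where
  "(x \<^bold>\<in> y) n = Mem (n - Suc x) (n - Suc y)"

definition eqL :: "nat \<Rightarrow> nat \<Rightarrow> lfm" (infix "\<^bold>=" 50) where
  "(x \<^bold>= y) n = Eq (n - Suc x) (n - Suc y)"

definition notL :: "lfm \<Rightarrow> lfm" ("\<^bold>\<not> _" [40] 40) where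
  "(\<^bold>\<not> F) n = Neg (F n)"

definition impL :: "lfm \<Rightarrow> lfm \<Rightarrow> lfm" (infixr "\<^bold>\<longrightarrow>" 25) where
  "(F \<^bold>\<longrightarrow> G) n = Imp (F n) (G n)"

definition andL :: "lfm \<Rightarrow> lfm \<Rightarrow> lfm" (infixr "\<^bold>\<and>" 35) where
  "(F \<^bold>\<and> G) = (\<^bold>\<not> (F \<^bold>\<longrightarrow> \<^bold>\<not> G))"

definition orL :: "lfm \<Rightarrow> lfm \<Rightarrow> lfm" (infixr "\<^bold>\<or>" 30) where
  "(F \<^bold>\<or> G) = (\<^bold>\<not> F \<^bold>\<longrightarrow> G)"

definition iffL :: "lfm \<Rightarrow> lfm \<Rightarrow> lfm" (infixr "\<^bold>\<longleftrightarrow>" 25) where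
  "(F \<^bold>\<longleftrightarrow> G) = ((F \<^bold>\<longrightarrow> G) \<^bold>\<and> (G \<^bold>\<longrightarrow> F))"

definition allL :: "(nat \<Rightarrow> lfm) \<Rightarrow> lfm" (binder "\<^bold>\<forall>" 10) where
  "allL B n = All (B n (Suc n))"

definition exL :: "(nat \<Rightarrow> lfm) \<Rightarrow> lfm" (binder "\<^bold>\<exists>" 10) where
  "(\<^bold>\<exists>x. B x) = (\<^bold>\<not> (\<^bold>\<forall>x. \<^bold>\<not> B x))"

definition ballL :: "nat \<Rightarrow> (nat \<Rightarrow> lfm) \<Rightarrow> lfm" where
  "ballL a B = (\<^bold>\<forall>x. x \<^bold>\<in> a \<^bold>\<longrightarrow> B x)"

definition bexL :: "nat \<Rightarrow> (nat \<Rightarrow> lfm) \<Rightarrow> lfm" where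
  "bexL a B = (\<^bold>\<exists>x. x \<^bold>\<in> a \<^bold>\<and> B x)"

text \<open>For the schemes: index \<open>0\<close> of the formula \<open>p\<close> is its distinguished variable, and
  index \<open>Suc i\<close> is its \<open>i\<close>-th parameter. \<open>closure k F\<close> binds \<open>k\<close> parameters by outermost universal
  quantifiers, at levels \<open>0, \<dots>, k - 1\<close>; \<open>appL p x\<close> is \<open>p(x)\<close> with these parameters.\<close>

definition appL :: "fm \<Rightarrow> nat \<Rightarrow> lfm" where
  "appL p x n = ren (case_nat (n - Suc x) (\<lambda>i. n - Suc i)) p"

definition closure :: "nat \<Rightarrow> lfm \<Rightarrow> fm" where
  "closure k F = (All ^^ k) (F k)"


section \<open>Elementary set theory\<close>

definition is_empty :: "nat \<Rightarrow> lfm" where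
  "is_empty x = (\<^bold>\<forall>y. \<^bold>\<not> y \<^bold>\<in> x)"

definition subset :: "nat \<Rightarrow> nat \<Rightarrow> lfm" where
  "subset x y = ballL x (\<lambda>z. z \<^bold>\<in> y)"

text \<open>\<open>z = {x, y}\<close>, \<open>z = \<langle>x, y\<rangle>\<close> (Kuratowski), \<open>z = x \<union> {x}\<close>, \<open>z = \<Union>x\<close>, \<open>z = x \<times> y\<close>.\<close>

definition is_upair :: "nat \<Rightarrow> nat \<Rightarrow> nat \<Rightarrow> lfm" where
  "is_upair z x y = (\<^bold>\<forall>w. w \<^bold>\<in> z \<^bold>\<longleftrightarrow> w \<^bold>= x \<^bold>\<or> w \<^bold>= y)"

definition is_pair :: "nat \<Rightarrow> nat \<Rightarrow> nat \<Rightarrow> lfm" where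
  "is_pair z x y = (\<^bold>\<exists>u. \<^bold>\<exists>v. is_upair u x x \<^bold>\<and> is_upair v x y \<^bold>\<and> is_upair z u v)"

definition is_suc :: "nat \<Rightarrow> nat \<Rightarrow> lfm" where
  "is_suc z x = (\<^bold>\<forall>w. w \<^bold>\<in> z \<^bold>\<longleftrightarrow> w \<^bold>\<in> x \<^bold>\<or> w \<^bold>= x)"

definition is_Union :: "nat \<Rightarrow> nat \<Rightarrow> lfm" where
  "is_Union z x = (\<^bold>\<forall>w. w \<^bold>\<in> z \<^bold>\<longleftrightarrow> bexL x (\<lambda>y. w \<^bold>\<in> y))"

definition is_prod :: "nat \<Rightarrow> nat \<Rightarrow> nat \<Rightarrow> lfm" where
  "is_prod z x y = (\<^bold>\<forall>p. p \<^bold>\<in> z \<^bold>\<longleftrightarrow> bexL x (\<lambda>a. bexL y (\<lambda>b. is_pair p a b)))"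

definition Ord :: "nat \<Rightarrow> lfm" where
  "Ord x = (ballL x (\<lambda>y. subset y x) \<^bold>\<and>
            ballL x (\<lambda>y. ballL x (\<lambda>z. y \<^bold>\<in> z \<^bold>\<or> y \<^bold>= z \<^bold>\<or> z \<^bold>\<in> y)))"

definition Succ :: "nat \<Rightarrow> lfm" where
  "Succ x = bexL x (\<lambda>y. is_suc x y)"

definition Nat :: "nat \<Rightarrow> lfm" where
  "Nat x = (Ord x \<^bold>\<and> (\<^bold>\<forall>y. y \<^bold>\<in> x \<^bold>\<or> y \<^bold>= x \<^bold>\<longrightarrow> is_empty y \<^bold>\<or> Succ y))"

definition ax_extensionality :: lfm where
  "ax_extensionality = (\<^bold>\<forall>x. \<^bold>\<forall>y. (\<^bold>\<forall>z. z \<^bold>\<in> x \<^bold>\<longleftrightarrow> z \<^bold>\<in> y) \<^bold>\<longrightarrow> x \<^bold>= y)"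

definition ax_empty :: lfm where
  "ax_empty = (\<^bold>\<exists>x. is_empty x)"

definition ax_pairing :: lfm where
  "ax_pairing = (\<^bold>\<forall>x. \<^bold>\<forall>y. \<^bold>\<exists>z. is_upair z x y)"

definition ax_union :: lfm where
  "ax_union = (\<^bold>\<forall>x. \<^bold>\<exists>z. is_Union z x)"

definition ax_product :: lfm where
  "ax_product = (\<^bold>\<forall>x. \<^bold>\<forall>y. \<^bold>\<exists>z. is_prod z x y)"

definition separation :: "fm \<Rightarrow> lfm" where
  "separation p = (\<^bold>\<forall>a. \<^bold>\<exists>b. \<^bold>\<forall>x. x \<^bold>\<in> b \<^bold>\<longleftrightarrow> x \<^bold>\<in> a \<^bold>\<and> appL p x)"

definition induction :: "fm \<Rightarrow> lfm" where
  "induction p =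
     ((\<^bold>\<forall>x. appL p x \<^bold>\<longrightarrow> Nat x) \<^bold>\<longrightarrow>
      (\<^bold>\<forall>e. is_empty e \<^bold>\<longrightarrow> appL p e) \<^bold>\<and>
      (\<^bold>\<forall>x. Nat x \<^bold>\<longrightarrow> appL p x \<^bold>\<longrightarrow> (\<^bold>\<forall>y. is_suc y x \<^bold>\<longrightarrow> appL p y)) \<^bold>\<longrightarrow>
      (\<^bold>\<forall>x. Nat x \<^bold>\<longrightarrow> appL p x))"

definition EST :: "fm set" where
  "EST = {ax_extensionality 0, ax_empty 0, ax_pairing 0, ax_union 0, ax_product 0}
         \<union> {closure k (separation p) | k p. Delta0 p \<and> fv p \<subseteq> {..k}}
         \<union> {closure k (induction p) | k p. fv p \<subseteq> {..k}}"

definition omega_is_set :: lfm where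
  "omega_is_set = (\<^bold>\<exists>w. \<^bold>\<forall>x. x \<^bold>\<in> w \<^bold>\<longleftrightarrow> Nat x)"

definition ax_infinity :: lfm where
  "ax_infinity = (\<^bold>\<exists>w. bexL w (\<lambda>e. is_empty e) \<^bold>\<and>
                       ballL w (\<lambda>x. bexL w (\<lambda>y. is_suc y x)))"


section \<open>Structures and coded formulas, inside set theory\<close>

text \<open>\<open>f(x) = y\<close>; \<open>f\<close> is a function with domain \<open>d\<close>; \<open>f : d \<rightarrow> c\<close>.\<close>

definition app :: "nat \<Rightarrow> nat \<Rightarrow> nat \<Rightarrow> lfm" where
  "app f x y = bexL f (\<lambda>p. is_pair p x y)"

definition fun_dom :: "nat \<Rightarrow> nat \<Rightarrow> lfm" where
  "fun_dom f d =
     (ballL f (\<lambda>p. bexL d (\<lambda>x. \<^bold>\<exists>y. is_pair p x y)) \<^bold>\<and>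
      ballL d (\<lambda>x. \<^bold>\<exists>y. app f x y \<^bold>\<and> (\<^bold>\<forall>z. app f x z \<^bold>\<longrightarrow> z \<^bold>= y)))"

definition fun_into :: "nat \<Rightarrow> nat \<Rightarrow> nat \<Rightarrow> lfm" where
  "fun_into f d c = (fun_dom f d \<^bold>\<and> (\<^bold>\<forall>x. \<^bold>\<forall>y. app f x y \<^bold>\<longrightarrow> y \<^bold>\<in> c))"

text \<open>Tuples are iterated pairs, \<open>\<langle>x, y, z, w\<rangle> = \<langle>\<langle>\<langle>x, y\<rangle>, z\<rangle>, w\<rangle>\<close>.\<close>

definition is_quad :: "nat \<Rightarrow> nat \<Rightarrow> nat \<Rightarrow> nat \<Rightarrow> nat \<Rightarrow> lfm" where
  "is_quad q x y z w = (\<^bold>\<exists>s. \<^bold>\<exists>t. is_pair s x y \<^bold>\<and> is_pair t s z \<^bold>\<and> is_pair q t w)"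

text \<open>\<open>q = \<langle>M, U, R, I\<rangle>\<close> is a structure for the language with constants from \<open>A\<close>. As usual in
  first-order logic, universes are nonempty. A language without \<open>U\<close> or \<open>R\<close> is obtained by taking
  the corresponding component to be empty.\<close>

definition is_struct :: "nat \<Rightarrow> nat \<Rightarrow> nat \<Rightarrow> nat \<Rightarrow> nat \<Rightarrow> nat \<Rightarrow> lfm" where
  "is_struct A q M U R I =
     (is_quad q M U R I \<^bold>\<and> \<^bold>\<not> is_empty M \<^bold>\<and> subset U M \<^bold>\<and>
      ballL R (\<lambda>p. bexL M (\<lambda>a. bexL M (\<lambda>b. is_pair p a b))) \<^bold>\<and> fun_into I A M)"

definition Struct :: "nat \<Rightarrow> nat \<Rightarrow> lfm" where
  "Struct A q = (\<^bold>\<exists>M. \<^bold>\<exists>U. \<^bold>\<exists>R. \<^bold>\<exists>I. is_struct A q M U R I)"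

text \<open>\<open>is_num k x\<close>: \<open>x\<close> is the von Neumann numeral of \<open>k\<close>; \<open>tag1\<close>: \<open>z = \<langle>k, x\<rangle>\<close>;
  \<open>tag2\<close>: \<open>z = \<langle>k, \<langle>x, y\<rangle>\<rangle>\<close>.\<close>

primrec is_num :: "nat \<Rightarrow> nat \<Rightarrow> lfm" where
  "is_num 0 x = is_empty x"
| "is_num (Suc k) x = (\<^bold>\<exists>y. is_num k y \<^bold>\<and> is_suc x y)"

definition tag1 :: "nat \<Rightarrow> nat \<Rightarrow> nat \<Rightarrow> lfm" where
  "tag1 k z x = (\<^bold>\<exists>t. is_num k t \<^bold>\<and> is_pair z t x)"

definition tag2 :: "nat \<Rightarrow> nat \<Rightarrow> nat \<Rightarrow> nat \<Rightarrow> lfm" where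
  "tag2 k z x y = (\<^bold>\<exists>p. is_pair p x y \<^bold>\<and> tag1 k z p)"

text \<open>The codes, as relations with the code as first argument.\<close>

definition c_var :: "nat \<Rightarrow> nat \<Rightarrow> lfm" where "c_var z i = tag1 0 z i"
definition c_const :: "nat \<Rightarrow> nat \<Rightarrow> lfm" where "c_const z a = tag1 1 z a"
definition c_eq :: "nat \<Rightarrow> nat \<Rightarrow> nat \<Rightarrow> lfm" where "c_eq z t u = tag2 2 z t u"
definition c_U :: "nat \<Rightarrow> nat \<Rightarrow> lfm" where "c_U z t = tag1 3 z t"
definition c_R :: "nat \<Rightarrow> nat \<Rightarrow> nat \<Rightarrow> lfm" where "c_R z t u = tag2 4 z t u"
definition c_neg :: "nat \<Rightarrow> nat \<Rightarrow> lfm" where "c_neg z p = tag1 5 z p"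
definition c_and :: "nat \<Rightarrow> nat \<Rightarrow> nat \<Rightarrow> lfm" where "c_and z p q = tag2 6 z p q"
definition c_ex :: "nat \<Rightarrow> nat \<Rightarrow> nat \<Rightarrow> lfm" where "c_ex z v p = tag2 7 z v p"

definition Var :: "nat \<Rightarrow> lfm" where
  "Var z = (\<^bold>\<exists>i. Nat i \<^bold>\<and> c_var z i)"

definition Term :: "nat \<Rightarrow> nat \<Rightarrow> lfm" where
  "Term A z = (Var z \<^bold>\<or> bexL A (\<lambda>a. c_const z a))"

text \<open>\<open>s\<close> is a formation sequence with index set \<open>d \<in> \<omega>\<close>.\<close>

definition formation :: "nat \<Rightarrow> nat \<Rightarrow> nat \<Rightarrow> lfm" where
  "formation A d s =
     (Nat d \<^bold>\<and> fun_dom s d \<^bold>\<and>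
      ballL d (\<lambda>i. \<^bold>\<exists>z. app s i z \<^bold>\<and>
       ((\<^bold>\<exists>t. \<^bold>\<exists>u. Term A t \<^bold>\<and> Term A u \<^bold>\<and> c_eq z t u) \<^bold>\<or>
        (\<^bold>\<exists>t. Term A t \<^bold>\<and> c_U z t) \<^bold>\<or>
        (\<^bold>\<exists>t. \<^bold>\<exists>u. Term A t \<^bold>\<and> Term A u \<^bold>\<and> c_R z t u) \<^bold>\<or>
        bexL i (\<lambda>j. \<^bold>\<exists>p. app s j p \<^bold>\<and> c_neg z p) \<^bold>\<or>
        bexL i (\<lambda>j. bexL i (\<lambda>k. \<^bold>\<exists>p. \<^bold>\<exists>q. app s j p \<^bold>\<and> app s k q \<^bold>\<and> c_and z p q)) \<^bold>\<or>
        bexL i (\<lambda>j. \<^bold>\<exists>p. \<^bold>\<exists>v. app s j p \<^bold>\<and> Var v \<^bold>\<and> c_ex z v p))))"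

definition Formula :: "nat \<Rightarrow> nat \<Rightarrow> lfm" where
  "Formula A z = (\<^bold>\<exists>d. \<^bold>\<exists>s. \<^bold>\<exists>m. formation A d s \<^bold>\<and> is_suc d m \<^bold>\<and> app s m z)"


section \<open>Satisfaction and elementary embeddings, inside set theory\<close>

text \<open>Assignments for the variables \<open>v_0, \<dots>, v_(n-1)\<close> are elements of the iterated Cartesian
  product \<open>M\<^sup>n\<close>, where \<open>M\<^sup>0 = {\<emptyset>}\<close> and \<open>M\<^sup>n\<^sup>+\<^sup>1 = M\<^sup>n \<times> M\<close>. Unlike the set of all functions
  from \<open>n\<close> to \<open>M\<close>, this can be shown to be a set from the axiom of Cartesian products without using
  replacement or power sets.

  \<open>is_power X M n\<close>: \<open>X = M\<^sup>n\<close>, witnessed by the sequence \<open>M\<^sup>0, \<dots>, M\<^sup>n\<close>.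
  \<open>coord x n k a\<close>: \<open>a\<close> is the \<open>k\<close>-th entry of the \<open>n\<close>-tuple \<open>x\<close>, witnessed by the sequence of
  its initial segments.\<close>

definition is_power :: "nat \<Rightarrow> nat \<Rightarrow> nat \<Rightarrow> lfm" where
  "is_power X M n =
     (\<^bold>\<exists>d. \<^bold>\<exists>P. Nat n \<^bold>\<and> is_suc d n \<^bold>\<and> fun_dom P d \<^bold>\<and>
       (\<^bold>\<exists>e. \<^bold>\<exists>Y. is_empty e \<^bold>\<and> is_upair Y e e \<^bold>\<and> app P e Y) \<^bold>\<and>
       ballL n (\<lambda>i. \<^bold>\<exists>j. \<^bold>\<exists>Y. \<^bold>\<exists>Z.
         is_suc j i \<^bold>\<and> app P i Y \<^bold>\<and> app P j Z \<^bold>\<and> is_prod Z Y M) \<^bold>\<and>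
       app P n X)"

definition coord :: "nat \<Rightarrow> nat \<Rightarrow> nat \<Rightarrow> nat \<Rightarrow> lfm" where
  "coord x n k a =
     (\<^bold>\<exists>d. \<^bold>\<exists>t. k \<^bold>\<in> n \<^bold>\<and> is_suc d n \<^bold>\<and> fun_dom t d \<^bold>\<and> app t n x \<^bold>\<and>
       ballL n (\<lambda>i. \<^bold>\<exists>j. \<^bold>\<exists>y. \<^bold>\<exists>z. \<^bold>\<exists>b.
         is_suc j i \<^bold>\<and> app t i y \<^bold>\<and> app t j z \<^bold>\<and> is_pair z y b \<^bold>\<and>
         (i \<^bold>= k \<^bold>\<longrightarrow> b \<^bold>= a)))"

text \<open>\<open>a\<close> is the value of the term \<open>t\<close> under the assignment \<open>x \<in> M\<^sup>n\<close>; there is none if \<open>t\<close> is a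
  variable \<open>v_k\<close> with \<open>k \<ge> n\<close>.\<close>

definition val :: "nat \<Rightarrow> nat \<Rightarrow> nat \<Rightarrow> nat \<Rightarrow> nat \<Rightarrow> lfm" where
  "val I n x t a =
     ((\<^bold>\<exists>c. c_const t c \<^bold>\<and> app I c a) \<^bold>\<or> bexL n (\<lambda>k. c_var t k \<^bold>\<and> coord x n k a))"

definition Term_below :: "nat \<Rightarrow> nat \<Rightarrow> nat \<Rightarrow> lfm" where
  "Term_below A n z = (bexL n (\<lambda>k. c_var z k) \<^bold>\<or> bexL A (\<lambda>a. c_const z a))"

text \<open>\<open>x\<close> and \<open>y\<close> agree except possibly at \<open>k\<close>.\<close>

definition agree_off :: "nat \<Rightarrow> nat \<Rightarrow> nat \<Rightarrow> nat \<Rightarrow> lfm" where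
  "agree_off n k x y =
     ballL n (\<lambda>j. j \<^bold>= k \<^bold>\<or> (\<^bold>\<exists>a. coord x n j a \<^bold>\<and> coord y n j a))"

text \<open>\<open>Y = {x \<in> X. F x}\<close>\<close>

definition is_Sep :: "nat \<Rightarrow> nat \<Rightarrow> (nat \<Rightarrow> lfm) \<Rightarrow> lfm" where
  "is_Sep Y X F = (\<^bold>\<forall>x. x \<^bold>\<in> Y \<^bold>\<longleftrightarrow> x \<^bold>\<in> X \<^bold>\<and> F x)"

text \<open>\<open>s\<close> is a formation sequence of formulas with all variables among \<open>v_0, \<dots>, v_(n-1)\<close>, and
  \<open>S\<close> assigns to each index \<open>i\<close> the set of \<open>x \<in> X = M\<^sup>n\<close> satisfying the formula \<open>s(i)\<close>, according to
  Tarski's clauses.\<close>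

definition sat_seq ::
  "nat \<Rightarrow> nat \<Rightarrow> nat \<Rightarrow> nat \<Rightarrow> nat \<Rightarrow> nat \<Rightarrow> nat \<Rightarrow> nat \<Rightarrow> nat \<Rightarrow> lfm" where
  "sat_seq A U R I n X d s S =
     (Nat d \<^bold>\<and> fun_dom s d \<^bold>\<and> fun_dom S d \<^bold>\<and>
      ballL d (\<lambda>i. \<^bold>\<exists>z. \<^bold>\<exists>Y. app s i z \<^bold>\<and> app S i Y \<^bold>\<and>
       ((\<^bold>\<exists>t. \<^bold>\<exists>u. Term_below A n t \<^bold>\<and> Term_below A n u \<^bold>\<and> c_eq z t u \<^bold>\<and>
           is_Sep Y X (\<lambda>x. \<^bold>\<exists>a. val I n x t a \<^bold>\<and> val I n x u a)) \<^bold>\<or>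
        (\<^bold>\<exists>t. Term_below A n t \<^bold>\<and> c_U z t \<^bold>\<and>
           is_Sep Y X (\<lambda>x. \<^bold>\<exists>a. val I n x t a \<^bold>\<and> a \<^bold>\<in> U)) \<^bold>\<or>
        (\<^bold>\<exists>t. \<^bold>\<exists>u. Term_below A n t \<^bold>\<and> Term_below A n u \<^bold>\<and> c_R z t u \<^bold>\<and>
           is_Sep Y X (\<lambda>x. \<^bold>\<exists>a. \<^bold>\<exists>b. val I n x t a \<^bold>\<and> val I n x u b \<^bold>\<and> app R a b)) \<^bold>\<or>
        bexL i (\<lambda>j. \<^bold>\<exists>p. \<^bold>\<exists>Z. app s j p \<^bold>\<and> app S j Z \<^bold>\<and> c_neg z p \<^bold>\<and>
           is_Sep Y X (\<lambda>x. \<^bold>\<not> x \<^bold>\<in> Z)) \<^bold>\<or>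
        bexL i (\<lambda>j. bexL i (\<lambda>k. \<^bold>\<exists>p. \<^bold>\<exists>q. \<^bold>\<exists>Z. \<^bold>\<exists>W.
           app s j p \<^bold>\<and> app s k q \<^bold>\<and> app S j Z \<^bold>\<and> app S k W \<^bold>\<and> c_and z p q \<^bold>\<and>
           is_Sep Y X (\<lambda>x. x \<^bold>\<in> Z \<^bold>\<and> x \<^bold>\<in> W))) \<^bold>\<or>
        bexL i (\<lambda>j. bexL n (\<lambda>k. \<^bold>\<exists>p. \<^bold>\<exists>v. \<^bold>\<exists>Z.
           app s j p \<^bold>\<and> app S j Z \<^bold>\<and> c_var v k \<^bold>\<and> c_ex z v p \<^bold>\<and>
           is_Sep Y X (\<lambda>x. bexL Z (\<lambda>y. agree_off n k x y)))))))"

text \<open>\<open>\<langle>M, U, R, I\<rangle> \<Turnstile> z[x]\<close> for \<open>x \<in> M\<^sup>n\<close>, where all variables of \<open>z\<close> are among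
  \<open>v_0, \<dots>, v_(n-1)\<close>; false if \<open>z\<close> has other variables.\<close>

definition Sat :: "nat \<Rightarrow> nat \<Rightarrow> nat \<Rightarrow> nat \<Rightarrow> nat \<Rightarrow> nat \<Rightarrow> nat \<Rightarrow> nat \<Rightarrow> lfm" where
  "Sat A M U R I z n x =
     (\<^bold>\<exists>X. \<^bold>\<exists>d. \<^bold>\<exists>m. \<^bold>\<exists>s. \<^bold>\<exists>S. \<^bold>\<exists>Y.
        is_power X M n \<^bold>\<and> sat_seq A U R I n X d s S \<^bold>\<and>
        is_suc d m \<^bold>\<and> app s m z \<^bold>\<and> app S m Y \<^bold>\<and> x \<^bold>\<in> Y)"

definition injective :: "nat \<Rightarrow> lfm" where
  "injective f = (\<^bold>\<forall>x. \<^bold>\<forall>y. \<^bold>\<forall>z. app f x z \<^bold>\<and> app f y z \<^bold>\<longrightarrow> x \<^bold>= y)"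

text \<open>The \<open>n\<close>-tuple \<open>y\<close> is the entrywise image of \<open>x\<close> under \<open>f\<close>.\<close>

definition maps_tuple :: "nat \<Rightarrow> nat \<Rightarrow> nat \<Rightarrow> nat \<Rightarrow> lfm" where
  "maps_tuple f n x y =
     ballL n (\<lambda>k. \<^bold>\<exists>a. \<^bold>\<exists>b. coord x n k a \<^bold>\<and> coord y n k b \<^bold>\<and> app f a b)"

text \<open>In the preservation clause, tuples too short for the variables of \<open>z\<close> contribute nothing,
  as then \<open>Sat\<close> is false on both sides.\<close>

definition elem_emb :: "nat \<Rightarrow> nat \<Rightarrow> nat \<Rightarrow> nat \<Rightarrow> lfm" where
  "elem_emb A f q r =
     (\<^bold>\<exists>M. \<^bold>\<exists>U. \<^bold>\<exists>R. \<^bold>\<exists>I. \<^bold>\<exists>N. \<^bold>\<exists>V. \<^bold>\<exists>Q. \<^bold>\<exists>J.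
        is_struct A q M U R I \<^bold>\<and> is_struct A r N V Q J \<^bold>\<and>
        fun_into f M N \<^bold>\<and> injective f \<^bold>\<and>
        (\<^bold>\<forall>z. \<^bold>\<forall>n. \<^bold>\<forall>X. \<^bold>\<forall>Y. \<^bold>\<forall>x. \<^bold>\<forall>y.
           Formula A z \<^bold>\<and> is_power X M n \<^bold>\<and> is_power Y N n \<^bold>\<and> x \<^bold>\<in> X \<^bold>\<and> y \<^bold>\<in> Y \<^bold>\<and>
           maps_tuple f n x y \<^bold>\<longrightarrow>
           (Sat A M U R I z n x \<^bold>\<longleftrightarrow> Sat A N V Q J z n y)))"


section \<open>Vopenka's principle\<close>

definition proper_class :: "fm \<Rightarrow> lfm" where
  "proper_class p =
     (\<^bold>\<forall>x. \<^bold>\<exists>y. (appL p y \<^bold>\<and> \<^bold>\<not> y \<^bold>\<in> x) \<^bold>\<or> (\<^bold>\<not> appL p y \<^bold>\<and> y \<^bold>\<in> x))"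

definition vopenka :: "fm \<Rightarrow> lfm" where
  "vopenka p =
     (\<^bold>\<forall>A. proper_class p \<^bold>\<and> (\<^bold>\<forall>x. appL p x \<^bold>\<longrightarrow> Struct A x) \<^bold>\<longrightarrow>
       (\<^bold>\<exists>q. \<^bold>\<exists>r. appL p q \<^bold>\<and> appL p r \<^bold>\<and> \<^bold>\<not> q \<^bold>= r \<^bold>\<and> (\<^bold>\<exists>f. elem_emb A f q r)))"

definition VP :: "fm set" where
  "VP = {closure k (vopenka p) | k p. fv p \<subseteq> {..k}}"

end

theory Submission
  imports Defs "HOL-Library.Countable" "HOL-Library.Infinite_Set"
begin

text \<open>By a Henkin completeness theorem it suffices to argue in an arbitrary model, possibly with
  nonstandard natural numbers, whose equality is true equality. Suppose that \<open>\<omega>\<close> is not a set. For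
  each natural number \<open>n \<noteq> 0\<close> let \<open>\<M>\<^sub>n\<close> be the path \<open>0 \<rightarrow> 1 \<rightarrow> \<dots> \<rightarrow> n\<close> with loops added at both
  ends. A set of all \<open>\<M>\<^sub>n\<close> would yield \<open>\<omega>\<close> by iterated unions, so they form a proper class. An
  elementary embedding \<open>f : \<M>\<^sub>n \<rightarrow> \<M>\<^sub>m\<close> is an injective homomorphism, by the single formula
  \<open>R(v_0, v_1)\<close>. It cannot collapse a step to a loop, hence \<open>f(0) = 0\<close>, and \<open>f(k) = k\<close> for all
  \<open>k \<le> n\<close> by induction. The loop at \<open>n \<noteq> 0\<close> must then be the one at \<open>m\<close>, so \<open>n = m\<close>, which
  contradicts Vopenka's principle.\<close>

section \<open>Completeness\<close>

lemma ren_cong: "(\<And>i. i \<in> fv p \<Longrightarrow> r i = s i) \<Longrightarrow> ren r p = ren s p"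
proof (induction p arbitrary: r s)
  case (All p)
  have "lift r i = lift s i" if "i \<in> fv p" for i
    using that All.prems by (cases i) auto
  then have "ren (lift r) p = ren (lift s) p" by (rule All.IH)
  then show ?case by simp
next
  case (Imp p q)
  have "ren r p = ren s p" by (rule Imp.IH(1)) (simp add: Imp.prems)
  moreover have "ren r q = ren s q" by (rule Imp.IH(2)) (simp add: Imp.prems)
  ultimately show ?case by simp
qed auto

lemma lift_comp: "lift r \<circ> lift s = lift (r \<circ> s)"
proof
  show "(lift r \<circ> lift s) i = lift (r \<circ> s) i" for i by (cases i) auto
qed

lemma ren_ren: "ren r (ren s p) = ren (r \<circ> s) p"
  by (induction p arbitrary: r s) (auto simp: lift_comp)

lemma lift_id: "lift (\<lambda>i. i) = (\<lambda>i. i)"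
proof
  show "lift (\<lambda>i. i) i = i" for i by (cases i) auto
qed

lemma ren_id: "ren (\<lambda>i. i) p = p"
  by (induction p) (auto simp: lift_id)

lemma ren_lift_Suc: "ren (lift r) (ren Suc p) = ren Suc (ren r p)"
  by (simp add: ren_ren comp_def)

lemma ren_inst: "ren r (inst t p) = inst (r t) (ren (lift r) p)"
  unfolding inst_def ren_ren
proof (rule ren_cong)
  show "(r \<circ> case_nat t (\<lambda>i. i)) i = (case_nat (r t) (\<lambda>i. i) \<circ> lift r) i" for i
    by (cases i) auto
qed

text \<open>In the term model an assignment is itself a renaming. This identity turns an instance of
  a renamed universal formula into an update of the assignment, as the quantifier case of
  \<open>truth\<close> requires.\<close>

lemma inst_ren_lift: "inst t (ren (lift r) p) = ren (case_nat t r) p"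
  unfolding inst_def ren_ren
proof (rule ren_cong)
  show "(case_nat t (\<lambda>i. i) \<circ> lift r) i = case_nat t r i" for i
    by (cases i) auto
qed

lemma fv_ren: "fv (ren r p) = r ` fv p"
proof (induction p arbitrary: r)
  case (All p)
  show ?case
  proof (intro set_eqI iffI)
    fix i assume "i \<in> fv (ren r (All p))"
    then obtain j where j: "j \<in> fv p" "Suc i = lift r j" by (auto simp: All)
    then show "i \<in> r ` fv (All p)" by (cases j) auto
  next
    fix i assume "i \<in> r ` fv (All p)"
    then obtain j where "Suc j \<in> fv p" "i = r j" by auto
    then show "i \<in> fv (ren r (All p))" using imageI[of "Suc j" "fv p" "lift r"] by (simp add: All)
  qed
qed auto

lemma finite_fv: "finite (fv p)"
proof (induction p)
  case (All p)
  have "fv (All p) \<subseteq> (\<lambda>i. i - 1) ` fv p" by force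
  then show ?case using All finite_surj by blast
qed auto

section \<open>Structural properties of derivability\<close>

lemma derives_mono: "G \<turnstile> p \<Longrightarrow> G \<subseteq> H \<Longrightarrow> H \<turnstile> p"
proof (induction arbitrary: H rule: derives.induct)
  case (ImpI p G q)
  then show ?case by (meson derives.ImpI insert_mono)
next
  case (Contr p G)
  then show ?case by (meson derives.Contr insert_mono)
next
  case (AllI G p)
  then show ?case by (meson derives.AllI image_mono)
next
  case (EqE G t u p)
  then show ?case by (meson derives.EqE)
qed (auto intro: derives.intros)

lemma derives_ren: "G \<turnstile> p \<Longrightarrow> ren r ` G \<turnstile> ren r p"
proof (induction arbitrary: r rule: derives.induct)
  case (AllI G p)
  \<comment> \<open>The premise lives under one more binder, so the induction hypothesis is used
    with \<open>lift r\<close>, which commutes with the shift of the context.\<close>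
  have "ren (lift r) ` ren Suc ` G = ren Suc ` ren r ` G"
    by (simp add: image_image ren_lift_Suc)
  then show ?case using AllI.IH[of "lift r"] by (auto intro: derives.AllI)
next
  case (AllE G p t)
  then show ?case by (auto simp: ren_inst intro: derives.AllE)
next
  case (EqE G t u p)
  then show ?case unfolding ren_inst by (auto intro: derives.EqE)
qed (auto intro: derives.intros)

text \<open>Each rule combines finitely many assumptions with those it discharges. This compactness
  keeps the union of the Henkin stages consistent.\<close>

lemma derives_finite: "G \<turnstile> p \<Longrightarrow> \<exists>H. finite H \<and> H \<subseteq> G \<and> H \<turnstile> p"
proof (induction rule: derives.induct)
  case (Assm p G)
  then show ?case by (intro exI[of _ "{p}"]) (auto intro: derives.Assm)
next
  case (ImpI p G q)
  then obtain H where H: "finite H" "H \<subseteq> insert p G" "H \<turnstile> q" by blast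
  then have "insert p (H - {p}) \<turnstile> q" by (auto intro: derives_mono)
  then show ?case using H by (intro exI[of _ "H - {p}"]) (auto intro: derives.ImpI)
next
  case (Contr p G)
  then obtain H where H: "finite H" "H \<subseteq> insert (Neg p) G" "H \<turnstile> Bot" by blast
  then have "insert (Neg p) (H - {Neg p}) \<turnstile> Bot" by (auto intro: derives_mono)
  then show ?case using H by (intro exI[of _ "H - {Neg p}"]) (auto intro: derives.Contr)
next
  case (ImpE G p q)
  then obtain H H' where "finite H" "H \<subseteq> G" "H \<turnstile> Imp p q" "finite H'" "H' \<subseteq> G" "H' \<turnstile> p"
    by blast
  then show ?case
    by (intro exI[of _ "H \<union> H'"]) (auto intro: derives.ImpE derives_mono)
next
  case (AllI G p)
  then obtain H where "finite H" "H \<subseteq> ren Suc ` G" "H \<turnstile> p" by blast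
  then obtain K where "finite K" "K \<subseteq> G" "H = ren Suc ` K" by (meson finite_subset_image)
  with \<open>H \<turnstile> p\<close> show ?case by (auto intro: derives.AllI)
next
  case (AllE G p t)
  then show ?case by (blast intro: derives.AllE)
next
  case (EqI G t)
  then show ?case by (blast intro: derives.EqI)
next
  case (EqE G t u p)
  then obtain H H' where "finite H" "H \<subseteq> G" "H \<turnstile> Eq t u" "finite H'" "H' \<subseteq> G" "H' \<turnstile> inst t p"
    by blast
  then show ?case
    by (intro exI[of _ "H \<union> H'"]) (auto intro: derives.EqE derives_mono)
qed

text \<open>Renaming the fresh variable to \<open>0\<close> and shifting all others turns \<open>inst c p\<close> into \<open>p\<close>.\<close>

lemma derives_generalize:
  assumes "G \<turnstile> inst c p" "\<And>q. q \<in> G \<Longrightarrow> c \<notin> fv q" "c \<notin> fv (All p)"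
  shows "G \<turnstile> All p"
proof -
  define r where "r i = (if i = c then 0 else Suc i)" for i
  have "ren r ` G = ren Suc ` G"
    by (intro image_cong refl ren_cong) (use assms(2) in \<open>auto simp: r_def\<close>)
  moreover have "ren r (inst c p) = ren (\<lambda>i. i) p"
    unfolding inst_def ren_ren
    by (rule ren_cong) (use assms(3) in \<open>auto simp: r_def split: nat.split\<close>)
  ultimately have "ren Suc ` G \<turnstile> p"
    using derives_ren[OF assms(1), of r] by (simp add: ren_id)
  then show ?thesis by (rule derives.AllI)
qed

section \<open>Extension to maximal consistent sets with witnesses\<close>

instance fm :: countable
  by countable_datatype

definition fresh :: "fm set \<Rightarrow> nat \<Rightarrow> bool" where
  "fresh G c \<longleftrightarrow> (\<forall>p\<in>G. c \<notin> fv p)"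

text \<open>Free variables act as Henkin constants, so the language stays the same. The
  comprehension has at most one element, because \<open>p\<close> determines
  \<open>q\<close>.\<close>

definition henkin_ext :: "fm \<Rightarrow> fm set \<Rightarrow> fm set" where
  "henkin_ext p G =
     (if insert p G \<turnstile> Bot then G
      else insert p G \<union>
        {Neg (inst (SOME c. fresh (insert p G) c) q) | q. p = Neg (All q)})"

primrec henkin_seq :: "fm set \<Rightarrow> nat \<Rightarrow> fm set" where
  "henkin_seq G 0 = G"
| "henkin_seq G (Suc n) = henkin_ext (from_nat n) (henkin_seq G n)"

text \<open>If the witness caused an inconsistency, the instance \<open>inst c q\<close> would be
  derivable with \<open>c\<close> free in no assumption. Generalization would give
  \<open>All q\<close>, against \<open>p\<close>.\<close>

lemma henkin_ext_consistent:
  assumes "\<not> G \<turnstile> Bot" "\<exists>c. fresh (insert p G) c"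
  shows "\<not> henkin_ext p G \<turnstile> Bot"
proof (cases "insert p G \<turnstile> Bot \<or> (\<forall>q. p \<noteq> Neg (All q))")
  case True
  then show ?thesis using assms(1) by (auto simp: henkin_ext_def)
next
  case False
  then obtain q where p: "p = Neg (All q)" by blast
  define c where "c = (SOME c. fresh (insert p G) c)"
  have fresh: "fresh (insert p G) c" unfolding c_def using assms(2) by (rule someI_ex)
  have eq: "henkin_ext p G = insert (Neg (inst c q)) (insert p G)"
    using False unfolding henkin_ext_def c_def by (auto simp: p)
  show ?thesis
  proof
    assume "henkin_ext p G \<turnstile> Bot"
    then have "insert p G \<turnstile> inst c q" unfolding eq by (rule derives.Contr)
    then have "insert p G \<turnstile> All q"
      by (rule derives_generalize) (use fresh in \<open>auto simp: fresh_def p\<close>)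
    then have "insert p G \<turnstile> Bot" by (metis derives.ImpE derives.Assm insertI1 p)
    with False show False by blast
  qed
qed

lemma fresh_henkin_ext:
  assumes "infinite {c. fresh G c}"
  shows "infinite {c. fresh (henkin_ext p G) c}" "\<exists>c. fresh (insert p G) c"
proof -
  define d where "d = (SOME c. fresh (insert p G) c)"
  have "\<exists>H. finite H \<and> henkin_ext p G \<subseteq> G \<union> H"
  proof (intro exI conjI)
    show "henkin_ext p G \<subseteq> G \<union> insert p ((\<lambda>q. Neg (inst d q)) ` {q. p = Neg (All q)})"
      by (auto simp: henkin_ext_def d_def)
    have "{q. p = Neg (All q)} \<subseteq> {THE q. p = Neg (All q)}" by auto
    then show "finite (insert p ((\<lambda>q. Neg (inst d q)) ` {q. p = Neg (All q)}))"
      using finite_subset by blast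
  qed
  then obtain H where H: "finite H" "henkin_ext p G \<subseteq> G \<union> H" by blast
  have inf: "infinite ({c. fresh G c} - (\<Union>q\<in>K. fv q))" if "finite K" for K
    using that assms finite_fv by auto
  have "{c. fresh G c} - (\<Union>q\<in>H. fv q) \<subseteq> {c. fresh (henkin_ext p G) c}"
    using H by (auto simp: fresh_def)
  with inf[OF H(1)] show "infinite {c. fresh (henkin_ext p G) c}" using infinite_super by blast
  have "{c. fresh G c} - (\<Union>q\<in>{p}. fv q) \<noteq> {}" using inf[of "{p}"] by (metis finite.emptyI finite_insert)
  then show "\<exists>c. fresh (insert p G) c" by (auto simp: fresh_def)
qed

text \<open>Variables will be the elements of the term model, so a refuted universal formula must
  have a variable as its counterexample.\<close>

locale henkin_set =
  fixes T :: "fm set"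
  assumes consistent: "\<not> T \<turnstile> Bot"
    and maximal: "p \<notin> T \<Longrightarrow> insert p T \<turnstile> Bot"
    and henkin: "Neg (All p) \<in> T \<Longrightarrow> \<exists>c. Neg (inst c p) \<in> T"

text \<open>In the union of the stages an inconsistency would already occur at some stage, and every
  formula is decided at the stage given by its code.\<close>

lemma henkin_set_exists:
  assumes "\<not> G \<turnstile> Bot" "infinite {c. fresh G c}"
  shows "\<exists>T. G \<subseteq> T \<and> henkin_set T"
proof -
  have inv: "\<not> henkin_seq G n \<turnstile> Bot \<and> infinite {c. fresh (henkin_seq G n) c}" for n
  proof (induction n)
    case 0
    then show ?case using assms by simp
  next
    case (Suc n)
    then show ?case by (simp add: henkin_ext_consistent fresh_henkin_ext)
  qed
  have step: "henkin_seq G n \<subseteq> henkin_seq G (Suc n)" for n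
    by (auto simp: henkin_ext_def)
  have mono: "henkin_seq G m \<subseteq> henkin_seq G n" if "m \<le> n" for m n
    using lift_Suc_mono_le[of "henkin_seq G", OF step that] .
  define T where "T = (\<Union>n. henkin_seq G n)"
  have fin: "\<exists>n. H \<subseteq> henkin_seq G n" if "finite H" "H \<subseteq> T" for H
    using that
  proof (induction H)
    case (insert p H)
    then obtain m n where "H \<subseteq> henkin_seq G n" "p \<in> henkin_seq G m" by (auto simp: T_def)
    then have "insert p H \<subseteq> henkin_seq G (max m n)"
      using mono[of m "max m n"] mono[of n "max m n"] by auto
    then show ?case by blast
  qed auto
  have cons: "\<not> T \<turnstile> Bot"
    using fin derives_finite derives_mono inv by meson
  show ?thesis
  proof (intro exI conjI)
    show "G \<subseteq> T" unfolding T_def using henkin_seq.simps(1) by blast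
    show "henkin_set T"
    proof
      show "\<not> T \<turnstile> Bot" by fact
    next
      fix p assume "p \<notin> T"
      \<comment> \<open>The formula is considered at stage \<open>to_nat p\<close> and can be left
        out there only if it is inconsistent with that stage.\<close>
      then have "p \<notin> henkin_seq G (Suc (to_nat p))" by (auto simp: T_def simp del: henkin_seq.simps)
      then have "insert p (henkin_seq G (to_nat p)) \<turnstile> Bot"
        by (auto simp: henkin_ext_def split: if_splits)
      then show "insert p T \<turnstile> Bot"
        by (rule derives_mono) (auto simp: T_def)
    next
      fix p assume T: "Neg (All p) \<in> T"
      let ?q = "Neg (All p)"
      have "\<not> insert ?q (henkin_seq G (to_nat ?q)) \<turnstile> Bot"
      proof
        assume "insert ?q (henkin_seq G (to_nat ?q)) \<turnstile> Bot"
        then have "T \<turnstile> Bot"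
          by (rule derives_mono) (use T in \<open>auto simp: T_def\<close>)
        with cons show False ..
      qed
      then have "\<exists>c. Neg (inst c p) \<in> henkin_seq G (Suc (to_nat ?q))"
        by (auto simp: henkin_ext_def)
      then show "\<exists>c. Neg (inst c p) \<in> T" unfolding T_def by blast
    qed
  qed
qed

context henkin_set
begin

lemma closed: "T \<turnstile> p \<Longrightarrow> p \<in> T"
  using consistent maximal derives.ImpI derives.ImpE by meson

lemma derives_iff: "T \<turnstile> p \<longleftrightarrow> p \<in> T"
  using closed derives.Assm by blast

lemma Bot_notin: "Bot \<notin> T"
  using consistent derives.Assm by blast

lemma Neg_iff: "Neg p \<in> T \<longleftrightarrow> p \<notin> T"
  by (metis closed consistent derives.Assm derives.ImpE derives.ImpI maximal)

lemma Imp_iff: "Imp p q \<in> T \<longleftrightarrow> (p \<in> T \<longrightarrow> q \<in> T)"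
proof
  assume "Imp p q \<in> T"
  then show "p \<in> T \<longrightarrow> q \<in> T" by (metis closed derives.Assm derives.ImpE)
next
  assume *: "p \<in> T \<longrightarrow> q \<in> T"
  have "insert p T \<turnstile> q"
  proof (cases "p \<in> T")
    case True
    then show ?thesis using * by (auto intro: derives.Assm)
  next
    case False
    then have "insert (Neg q) (insert p T) \<turnstile> Bot"
      using maximal derives_mono by blast
    then show ?thesis by (rule derives.Contr)
  qed
  then show "Imp p q \<in> T" by (auto intro: closed derives.ImpI)
qed

text \<open>For the converse direction: if the universal formula is absent, its negation is present
  and brings a witness refuting one instance.\<close>

lemma All_iff: "All p \<in> T \<longleftrightarrow> (\<forall>t. inst t p \<in> T)"
  by (metis Neg_iff closed derives.AllE derives_iff henkin)

lemma Eq_refl: "Eq i i \<in> T"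
  by (simp add: closed derives.EqI)

lemma Eq_subst: "Eq i j \<in> T \<Longrightarrow> inst i p \<in> T \<Longrightarrow> inst j p \<in> T"
  using derives.EqE derives_iff by blast

text \<open>Leibniz's law for the predicate of being equal to \<open>i\<close>, written
  \<open>Eq 0 (Suc i)\<close> with index \<open>0\<close> as the place of substitution.\<close>

lemma Eq_sym: "Eq i j \<in> T \<Longrightarrow> Eq j i \<in> T"
  using Eq_subst[of i j "Eq 0 (Suc i)"] Eq_refl by (simp add: inst_def)

lemma Eq_trans: "Eq i j \<in> T \<Longrightarrow> Eq j k \<in> T \<Longrightarrow> Eq i k \<in> T"
  using Eq_subst[of j k "Eq (Suc i) 0"] by (simp add: inst_def)

lemma Mem_cong: "Eq i i' \<in> T \<Longrightarrow> Eq j j' \<in> T \<Longrightarrow> Mem i j \<in> T \<Longrightarrow> Mem i' j' \<in> T"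
  using Eq_subst[of i i' "Mem 0 (Suc j)"] Eq_subst[of j j' "Mem (Suc i') 0"]
  by (simp add: inst_def)

end

section \<open>Tarskian semantics and the term model\<close>

text \<open>Equality is interpreted by any relation \<open>Q\<close>: in the term model it is first
  a mere congruence and becomes identity only in the quotient.\<close>

primrec sat :: "('a \<Rightarrow> 'a \<Rightarrow> bool) \<Rightarrow> ('a \<Rightarrow> 'a \<Rightarrow> bool) \<Rightarrow> (nat \<Rightarrow> 'a) \<Rightarrow> fm \<Rightarrow> bool" where
  "sat Q E v Bot = False"
| "sat Q E v (Mem i j) = E (v i) (v j)"
| "sat Q E v (Eq i j) = Q (v i) (v j)"
| "sat Q E v (Imp p q) = (sat Q E v p \<longrightarrow> sat Q E v q)"
| "sat Q E v (All p) = (\<forall>x. sat Q E (case_nat x v) p)"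

lemma sat_cong: "(\<And>i. i \<in> fv p \<Longrightarrow> v i = w i) \<Longrightarrow> sat Q E v p = sat Q E w p"
proof (induction p arbitrary: v w)
  case (All p)
  have "sat Q E (case_nat x v) p = sat Q E (case_nat x w) p" for x
    by (rule All.IH) (use All.prems in \<open>auto split: nat.split\<close>)
  then show ?case by simp
next
  case (Imp p q)
  have "sat Q E v p = sat Q E w p" by (rule Imp.IH(1)) (simp add: Imp.prems)
  moreover have "sat Q E v q = sat Q E w q" by (rule Imp.IH(2)) (simp add: Imp.prems)
  ultimately show ?case by simp
qed auto

lemma sat_ren: "sat Q E v (ren r p) = sat Q E (v \<circ> r) p"
proof (induction p arbitrary: v r)
  case (All p)
  have "case_nat x v \<circ> lift r = case_nat x (v \<circ> r)" for x
  proof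
    show "(case_nat x v \<circ> lift r) i = case_nat x (v \<circ> r) i" for i by (cases i) auto
  qed
  then show ?case by (simp only: ren.simps sat.simps All)
qed auto

lemma (in henkin_set) truth:
  "sat (\<lambda>i j. Eq i j \<in> T) (\<lambda>i j. Mem i j \<in> T) v p \<longleftrightarrow> ren v p \<in> T"
  by (induction p arbitrary: v) (auto simp: Bot_notin Imp_iff All_iff inst_ren_lift)

text \<open>Surjectivity of \<open>e\<close> makes the quantifiers on both sides range over the same
  values; the atomic cases are the two remaining assumptions.\<close>

lemma sat_quotient:
  assumes "surj e" "\<And>i j. Q i j \<longleftrightarrow> e i = e j" "\<And>i j. E i j \<longleftrightarrow> E' (e i) (e j)"
  shows "sat Q E v p \<longleftrightarrow> sat (=) E' (e \<circ> v) p"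
proof (induction p arbitrary: v)
  case (All p)
  have "case_nat (e x) (e \<circ> v) = e \<circ> case_nat x v" for x
  proof
    show "case_nat (e x) (e \<circ> v) i = (e \<circ> case_nat x v) i" for i by (cases i) auto
  qed
  then have "(\<forall>x. sat (=) E' (e \<circ> case_nat x v) p) \<longleftrightarrow> (\<forall>y. sat (=) E' (case_nat y (e \<circ> v)) p)"
    by (metis assms(1) surjD)
  then show ?case by (simp only: sat.simps All)
qed (auto simp: assms)

text \<open>Doubling all variables makes room for the Henkin witnesses; since no hypothesis on free
  variables remains, theories need not consist of sentences.\<close>

lemma henkin_model:
  assumes "\<not> G \<turnstile> p"
  shows "\<exists>T v. henkin_set T \<and>
    (\<forall>q\<in>insert (Neg p) G. sat (\<lambda>i j. Eq i j \<in> T) (\<lambda>i j. Mem i j \<in> T) v q)"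
proof -
  let ?d = "\<lambda>i::nat. 2 * i"
  let ?G = "ren ?d ` insert (Neg p) G"
  have "\<not> insert (Neg p) G \<turnstile> Bot" using assms derives.Contr by blast
  \<comment> \<open>Halving undoes the doubling, so an inconsistency of the renamed set would carry
    over to the original one.\<close>
  moreover have "ren (\<lambda>i. i div 2) ` ?G = insert (Neg p) G"
    by (simp add: image_image ren_ren comp_def ren_id)
  ultimately have "\<not> ?G \<turnstile> Bot"
    using derives_ren[of ?G Bot "\<lambda>i. i div 2"] by auto
  moreover have "infinite {c. fresh ?G c}"
  proof -
    have "2 * i + 1 \<notin> fv (ren ?d q)" for i q
      unfolding fv_ren by (auto; presburger)
    then have "range (\<lambda>i::nat. 2 * i + 1) \<subseteq> {c. fresh ?G c}"
      unfolding fresh_def by blast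
    moreover have "infinite (range (\<lambda>i::nat. 2 * i + 1))"
      by (rule range_inj_infinite) (auto simp: inj_on_def)
    ultimately show ?thesis using infinite_super by blast
  qed
  ultimately obtain T where "?G \<subseteq> T" "henkin_set T" using henkin_set_exists by blast
  then have "sat (\<lambda>i j. Eq i j \<in> T) (\<lambda>i j. Mem i j \<in> T) ?d q" if "q \<in> insert (Neg p) G" for q
    using that henkin_set.truth[of T ?d q] by blast
  with \<open>henkin_set T\<close> show ?thesis by blast
qed

text \<open>Under \<open>ev Q E v n \<rho> F\<close> the variable of level \<open>x < n\<close> has value \<open>\<rho> x\<close>; \<open>v\<close> interprets
  the remaining free indices.\<close>

definition ev :: "('a \<Rightarrow> 'a \<Rightarrow> bool) \<Rightarrow> ('a \<Rightarrow> 'a \<Rightarrow> bool) \<Rightarrow> (nat \<Rightarrow> 'a) \<Rightarrow>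
    nat \<Rightarrow> (nat \<Rightarrow> 'a) \<Rightarrow> lfm \<Rightarrow> bool" where
  "ev Q E v n \<rho> F = sat Q E (\<lambda>i. if i < n then \<rho> (n - Suc i) else v (i - n)) (F n)"

lemma upd_lt: "x < n \<Longrightarrow> (\<rho>(n := a)) x = \<rho> x" for x n :: nat
  by simp

lemma ev_mem: "x < n \<Longrightarrow> y < n \<Longrightarrow> ev Q E v n \<rho> (x \<^bold>\<in> y) \<longleftrightarrow> E (\<rho> x) (\<rho> y)"
  by (simp add: ev_def memL_def)

lemma ev_eq: "x < n \<Longrightarrow> y < n \<Longrightarrow> ev Q E v n \<rho> (x \<^bold>= y) \<longleftrightarrow> Q (\<rho> x) (\<rho> y)"
  by (simp add: ev_def eqL_def)

lemma ev_not: "ev Q E v n \<rho> (\<^bold>\<not> F) \<longleftrightarrow> \<not> ev Q E v n \<rho> F"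
  by (simp add: ev_def notL_def)

lemma ev_imp: "ev Q E v n \<rho> (F \<^bold>\<longrightarrow> G) \<longleftrightarrow> (ev Q E v n \<rho> F \<longrightarrow> ev Q E v n \<rho> G)"
  by (simp add: ev_def impL_def)

lemma ev_and: "ev Q E v n \<rho> (F \<^bold>\<and> G) \<longleftrightarrow> ev Q E v n \<rho> F \<and> ev Q E v n \<rho> G"
  by (simp add: andL_def ev_not ev_imp)

lemma ev_or: "ev Q E v n \<rho> (F \<^bold>\<or> G) \<longleftrightarrow> ev Q E v n \<rho> F \<or> ev Q E v n \<rho> G"
  by (auto simp: orL_def ev_not ev_imp)

lemma ev_iff: "ev Q E v n \<rho> (F \<^bold>\<longleftrightarrow> G) \<longleftrightarrow> (ev Q E v n \<rho> F \<longleftrightarrow> ev Q E v n \<rho> G)"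
  by (auto simp: iffL_def ev_and ev_imp)

text \<open>Entering a quantifier gives the new variable index \<open>0\<close> and level
  \<open>n\<close> and moves all other indices up by one, while their levels stay the same.\<close>

lemma env_shift: "case_nat a (\<lambda>i. if i < n then \<rho> (n - Suc i) else v (i - n)) =
    (\<lambda>i. if i < Suc n then (\<rho>(n := a)) (Suc n - Suc i) else v (i - Suc n))" for n :: nat
proof
  show "case_nat a (\<lambda>i. if i < n then \<rho> (n - Suc i) else v (i - n)) j =
      (if j < Suc n then (\<rho>(n := a)) (Suc n - Suc j) else v (j - Suc n))" for j
    by (cases j) auto
qed

lemma ev_all: "ev Q E v n \<rho> (allL B) \<longleftrightarrow> (\<forall>a. ev Q E v (Suc n) (\<rho>(n := a)) (B n))"
  by (simp only: ev_def allL_def sat.simps env_shift)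

lemma ev_ex: "ev Q E v n \<rho> (exL B) \<longleftrightarrow> (\<exists>a. ev Q E v (Suc n) (\<rho>(n := a)) (B n))"
  by (simp add: exL_def ev_not ev_all)

lemma ev_ball: "a < n \<Longrightarrow> ev Q E v n \<rho> (ballL a B) \<longleftrightarrow>
    (\<forall>x. E x (\<rho> a) \<longrightarrow> ev Q E v (Suc n) (\<rho>(n := x)) (B n))"
  by (simp add: ballL_def ev_all ev_imp ev_mem)

lemma ev_bex: "a < n \<Longrightarrow> ev Q E v n \<rho> (bexL a B) \<longleftrightarrow>
    (\<exists>x. E x (\<rho> a) \<and> ev Q E v (Suc n) (\<rho>(n := x)) (B n))"
  by (simp add: bexL_def ev_ex ev_and ev_mem)

lemmas ev_simps = ev_mem ev_eq ev_not ev_imp ev_and ev_or ev_iff ev_all ev_ex ev_ball ev_bex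

text \<open>Evaluation produces chains of updates at increasing levels; these rules read them
  without case distinctions on equality of levels.\<close>

declare fun_upd_apply [simp del] fun_upd_same [simp] upd_lt [simp]

lemma sat_sentence: "sat Q E v (F 0) \<longleftrightarrow> ev Q E v 0 \<rho> F"
  by (simp add: ev_def)

lemma sat_closure: "sat Q E v (closure k F) \<longleftrightarrow> (\<forall>\<rho>. ev Q E v k \<rho> F)"
proof -
  \<comment> \<open>The induction needs \<open>n\<close> levels already open: their values are those
    of \<open>\<rho>\<close>, while \<open>\<sigma>\<close> may vary at the \<open>k\<close> levels
    still to be bound.\<close>
  have "sat Q E (\<lambda>i. if i < n then \<rho> (n - Suc i) else v (i - n)) ((All ^^ k) (F (n + k))) \<longleftrightarrow>
      (\<forall>\<sigma>. (\<forall>i<n. \<sigma> i = \<rho> i) \<longrightarrow> ev Q E v (n + k) \<sigma> F)" for n \<rho>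
  proof (induction k arbitrary: n \<rho>)
    case 0
    have "ev Q E v n \<sigma> F = ev Q E v n \<rho> F" if "\<forall>i<n. \<sigma> i = \<rho> i" for \<sigma>
      unfolding ev_def by (rule sat_cong) (use that in auto)
    then have "ev Q E v n \<rho> F \<longleftrightarrow> (\<forall>\<sigma>. (\<forall>i<n. \<sigma> i = \<rho> i) \<longrightarrow> ev Q E v n \<sigma> F)"
      by blast
    then show ?case by (simp add: ev_def)
  next
    case (Suc k)
    have "sat Q E (\<lambda>i. if i < n then \<rho> (n - Suc i) else v (i - n))
        ((All ^^ Suc k) (F (n + Suc k))) \<longleftrightarrow>
      (\<forall>a. sat Q E (\<lambda>i. if i < Suc n then (\<rho>(n := a)) (Suc n - Suc i) else v (i - Suc n))
        ((All ^^ k) (F (Suc n + k))))"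
      by (simp only: funpow.simps comp_apply sat.simps env_shift add_Suc_shift)
    also have "\<dots> \<longleftrightarrow>
      (\<forall>a \<sigma>. (\<forall>i<Suc n. \<sigma> i = (\<rho>(n := a)) i) \<longrightarrow> ev Q E v (Suc n + k) \<sigma> F)"
      by (subst Suc.IH) (rule refl)
    also have "\<dots> \<longleftrightarrow> (\<forall>\<sigma>. (\<forall>i<n. \<sigma> i = \<rho> i) \<longrightarrow> ev Q E v (n + Suc k) \<sigma> F)"
    proof (intro iffI allI impI)
      fix \<sigma>
      assume *: "\<forall>a \<sigma>. (\<forall>i<Suc n. \<sigma> i = (\<rho>(n := a)) i) \<longrightarrow> ev Q E v (Suc n + k) \<sigma> F"
        and "\<forall>i<n. \<sigma> i = \<rho> i"
      then have "\<forall>i<Suc n. \<sigma> i = (\<rho>(n := \<sigma> n)) i" by (simp add: less_Suc_eq fun_upd_apply)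
      with * have "ev Q E v (Suc n + k) \<sigma> F" by blast
      then show "ev Q E v (n + Suc k) \<sigma> F" by simp
    next
      fix a \<sigma>
      assume *: "\<forall>\<sigma>. (\<forall>i<n. \<sigma> i = \<rho> i) \<longrightarrow> ev Q E v (n + Suc k) \<sigma> F"
        and "\<forall>i<Suc n. \<sigma> i = (\<rho>(n := a)) i"
      then have "\<forall>i<n. \<sigma> i = \<rho> i" by (simp add: less_Suc_eq fun_upd_apply)
      with * have "ev Q E v (n + Suc k) \<sigma> F" by blast
      then show "ev Q E v (Suc n + k) \<sigma> F" by simp
    qed
    finally show ?case .
  qed
  from this[of 0] show ?thesis unfolding closure_def by simp
qed

text \<open>The last assumption says that the first \<open>k\<close> levels still hold the
  parameters, however many quantifiers have been opened since.\<close>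

lemma ev_appL:
  assumes "fv p \<subseteq> {..k}" "k \<le> n" "x < n" "\<And>i. i < k \<Longrightarrow> \<rho> i = e i"
  shows "ev Q E v n \<rho> (appL p x) \<longleftrightarrow> sat Q E (case_nat (\<rho> x) e) p"
  unfolding ev_def appL_def sat_ren
  by (rule sat_cong) (use assms in \<open>auto split: nat.split\<close>)

section \<open>Countably infinite models with true equality\<close>

text \<open>If finitely many elements represented everything up to \<open>Q\<close>, Pairing and
  Union would collect them in a universal set, and Separation for the formula
  \<open>Neg (Mem 0 0)\<close> would yield Russell's paradox.\<close>

lemma no_finite_model:
  assumes Q: "\<And>x. Q x x" "\<And>x y z. Q x y \<Longrightarrow> E x z \<Longrightarrow> E y z"
    and EST: "\<And>p. p \<in> EST \<Longrightarrow> sat Q E v p" and "finite F"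
  shows "\<exists>x. \<forall>y\<in>F. \<not> Q y x"
proof (rule ccontr)
  assume F: "\<not> ?thesis"
  have "sat Q E v (ax_pairing 0)" "sat Q E v (ax_union 0)" using EST by (auto simp: EST_def)
  then have pairing: "\<exists>z. \<forall>w. E w z \<longleftrightarrow> Q w x \<or> Q w y" and union: "\<exists>z. \<forall>w. E w z \<longleftrightarrow> (\<exists>y. E y x \<and> E w y)"
    for x y
    by (simp_all add: sat_sentence[where \<rho> = v] ax_pairing_def ax_union_def is_upair_def is_Union_def
        ev_simps)
  have "closure 0 (separation (Neg (Mem 0 0))) \<in> EST"
    by (auto simp: EST_def intro!: Delta0.intros exI[of _ 0] exI[of _ "Neg (Mem 0 0)"])
  then have "sat Q E v (closure 0 (separation (Neg (Mem 0 0))))" by (rule EST)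
  then have sep: "\<exists>b. \<forall>x. E x b \<longleftrightarrow> E x a \<and> \<not> E x x" for a
    by (simp add: sat_closure separation_def ev_appL[where k = 0 and e = v] ev_simps)
  from \<open>finite F\<close> have "\<exists>a. \<forall>y\<in>F. E y a"
  proof induction
    case (insert y F)
    then obtain a where a: "\<forall>y\<in>F. E y a" by blast
    obtain s where s: "\<And>w. E w s \<longleftrightarrow> Q w y" using pairing[of y y] by auto
    obtain t where t: "\<And>w. E w t \<longleftrightarrow> Q w a \<or> Q w s" using pairing[of a s] by auto
    obtain b where b: "\<And>w. E w b \<longleftrightarrow> (\<exists>y. E y t \<and> E w y)" using union[of t] by auto
    have "E z b" if "E z a" for z unfolding b using t that Q(1) by blast
    moreover have "E y b" unfolding b using t s Q(1) by blast
    ultimately show ?case using a by blast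
  qed auto
  then obtain a where "\<And>y. E y a" using F Q(2) by blast
  then show False using sep[of a] by blast
qed

text \<open>The quotient of the term model is countable, and infinite by
  \<open>no_finite_model\<close>. It can therefore be carried over to all of \<open>nat\<close>, so
  one fixed type of universes suffices.\<close>

theorem EST_completeness:
  assumes "EST \<subseteq> G"
    and "\<And>(E :: nat \<Rightarrow> nat \<Rightarrow> bool) v. (\<And>q. q \<in> G \<Longrightarrow> sat (=) E v q) \<Longrightarrow> sat (=) E v p"
  shows "G \<turnstile> p"
proof (rule ccontr)
  assume "\<not> G \<turnstile> p"
  then obtain T v where "henkin_set T"
    and T: "\<And>q. q \<in> insert (Neg p) G \<Longrightarrow> sat (\<lambda>i j. Eq i j \<in> T) (\<lambda>i j. Mem i j \<in> T) v q"
    using henkin_model by blast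
  interpret henkin_set T by fact
  \<comment> \<open>The least variable of a congruence class represents the class.\<close>
  define rep where "rep i = (LEAST j. Eq j i \<in> T)" for i
  have rep: "Eq (rep i) i \<in> T" for i
    unfolding rep_def by (rule LeastI) (rule Eq_refl)
  have rep_eq: "rep i = rep j \<longleftrightarrow> Eq i j \<in> T" for i j
  proof
    assume "rep i = rep j"
    then show "Eq i j \<in> T" by (metis rep Eq_sym Eq_trans)
  next
    assume "Eq i j \<in> T"
    then have "(\<lambda>k. Eq k i \<in> T) = (\<lambda>k. Eq k j \<in> T)" using Eq_sym Eq_trans by blast
    then show "rep i = rep j" unfolding rep_def by simp
  qed
  have "infinite (range rep)"
  proof
    assume fin: "finite (range rep)"
    have "\<exists>x. \<forall>y\<in>range rep. Eq y x \<notin> T"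
    proof (rule no_finite_model[OF _ _ _ fin])
      show "Eq x x \<in> T" for x by (rule Eq_refl)
      show "Mem y z \<in> T" if "Eq x y \<in> T" "Mem x z \<in> T" for x y z
        using that Eq_refl Mem_cong by blast
      show "q \<in> EST \<Longrightarrow> sat (\<lambda>i j. Eq i j \<in> T) (\<lambda>i j. Mem i j \<in> T) v q" for q
        using T assms(1) by blast
    qed
    then show False using rep by blast
  qed
  then obtain h where h: "bij_betw h (range rep) (UNIV :: nat set)"
    using bij_betw_inv_into[OF bij_enumerate] by blast
  define e where "e = h \<circ> rep"
  define E where "E x y \<longleftrightarrow> Mem (inv e x) (inv e y) \<in> T" for x y
  have surj: "surj e" using h unfolding e_def bij_betw_def by (metis image_comp)
  have e_eq: "Eq i j \<in> T \<longleftrightarrow> e i = e j" for i j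
    using h unfolding e_def rep_eq[symmetric] bij_betw_def by (auto dest: inj_onD)
  have "Eq (inv e (e i)) i \<in> T" for i using e_eq surj by (simp add: surj_f_inv_f)
  then have "Mem i j \<in> T \<longleftrightarrow> E (e i) (e j)" for i j
    unfolding E_def using Mem_cong Eq_sym by meson
  then have "sat (\<lambda>i j. Eq i j \<in> T) (\<lambda>i j. Mem i j \<in> T) v q \<longleftrightarrow> sat (=) E (e \<circ> v) q" for q
    by (intro sat_quotient surj e_eq)
  with T have "sat (=) E (e \<circ> v) q" if "q \<in> insert (Neg p) G" for q
    using that by blast
  then show False using assms(2)[of E "e \<circ> v"] by fastforce
qed

section \<open>Models of elementary set theory\<close>

locale set_model =
  fixes E :: "'a \<Rightarrow> 'a \<Rightarrow> bool" (infix "\<in>\<^sub>m" 50) and u :: "nat \<Rightarrow> 'a"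
  assumes model: "p \<in> EST \<union> VP \<Longrightarrow> sat (=) E u p"
begin

lemma axiom: "F 0 \<in> EST \<Longrightarrow> ev (=) E u 0 \<rho> F"
  using model sat_sentence by blast

lemma extensionality: "(\<And>z. z \<in>\<^sub>m x \<longleftrightarrow> z \<in>\<^sub>m y) \<Longrightarrow> x = y"
  using axiom[of ax_extensionality u]
  by (simp add: EST_def ax_extensionality_def ev_simps)

section \<open>Set operations in the model\<close>

definition emp :: 'a where
  "emp = (SOME x. \<forall>y. \<not> y \<in>\<^sub>m x)"

definition upr :: "'a \<Rightarrow> 'a \<Rightarrow> 'a" where
  "upr x y = (SOME z. \<forall>w. w \<in>\<^sub>m z \<longleftrightarrow> w = x \<or> w = y)"

definition un :: "'a \<Rightarrow> 'a" where
  "un x = (SOME z. \<forall>w. w \<in>\<^sub>m z \<longleftrightarrow> (\<exists>y. y \<in>\<^sub>m x \<and> w \<in>\<^sub>m y))"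

definition pr :: "'a \<Rightarrow> 'a \<Rightarrow> 'a" where
  "pr x y = upr (upr x x) (upr x y)"

definition prd :: "'a \<Rightarrow> 'a \<Rightarrow> 'a" where
  "prd x y = (SOME z. \<forall>p. p \<in>\<^sub>m z \<longleftrightarrow> (\<exists>a. a \<in>\<^sub>m x \<and> (\<exists>b. b \<in>\<^sub>m y \<and> p = pr a b)))"

definition ins :: "'a \<Rightarrow> 'a \<Rightarrow> 'a" where
  "ins a x = un (upr (upr a a) x)"

definition suc :: "'a \<Rightarrow> 'a" where
  "suc x = ins x x"

definition num :: "nat \<Rightarrow> 'a" where
  "num k = (suc ^^ k) emp"

lemma mem_emp [simp]: "\<not> y \<in>\<^sub>m emp"
proof -
  have "\<exists>x. \<forall>y. \<not> y \<in>\<^sub>m x"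
    using axiom[of ax_empty u] by (simp add: EST_def ax_empty_def is_empty_def ev_simps)
  from someI_ex[OF this] show ?thesis unfolding emp_def by blast
qed

lemma mem_upr [simp]: "w \<in>\<^sub>m upr x y \<longleftrightarrow> w = x \<or> w = y"
proof -
  have "\<exists>z. \<forall>w. w \<in>\<^sub>m z \<longleftrightarrow> w = x \<or> w = y"
    using axiom[of ax_pairing u] by (simp add: EST_def ax_pairing_def is_upair_def ev_simps)
  from someI_ex[OF this] show ?thesis unfolding upr_def by blast
qed

lemma mem_un [simp]: "w \<in>\<^sub>m un x \<longleftrightarrow> (\<exists>y. y \<in>\<^sub>m x \<and> w \<in>\<^sub>m y)"
proof -
  have "\<exists>z. \<forall>w. w \<in>\<^sub>m z \<longleftrightarrow> (\<exists>y. y \<in>\<^sub>m x \<and> w \<in>\<^sub>m y)"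
    using axiom[of ax_union u] by (simp add: EST_def ax_union_def is_Union_def ev_simps)
  from someI_ex[OF this] show ?thesis unfolding un_def by blast
qed

lemma mem_ins [simp]: "w \<in>\<^sub>m ins a x \<longleftrightarrow> w = a \<or> w \<in>\<^sub>m x"
  by (auto simp: ins_def)

lemma mem_suc [simp]: "w \<in>\<^sub>m suc x \<longleftrightarrow> w \<in>\<^sub>m x \<or> w = x"
  by (auto simp: suc_def)

lemma ext_iff: "x = y \<longleftrightarrow> (\<forall>z. z \<in>\<^sub>m x \<longleftrightarrow> z \<in>\<^sub>m y)"
  using extensionality by blast

lemma upr_eq_iff: "upr a b = upr c d \<longleftrightarrow> a = c \<and> b = d \<or> a = d \<and> b = c"
  unfolding ext_iff[of "upr a b"] mem_upr by metis

lemma pr_eq_iff [simp]: "pr a b = pr c d \<longleftrightarrow> a = c \<and> b = d"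
  by (auto simp: pr_def upr_eq_iff)

lemma ev_is_empty: "x < n \<Longrightarrow> ev (=) E v n \<rho> (is_empty x) \<longleftrightarrow> \<rho> x = emp"
  by (simp add: is_empty_def ev_simps ext_iff[of _ emp])

lemma ev_is_upair: "z < n \<Longrightarrow> x < n \<Longrightarrow> y < n \<Longrightarrow>
    ev (=) E v n \<rho> (is_upair z x y) \<longleftrightarrow> \<rho> z = upr (\<rho> x) (\<rho> y)"
  by (simp add: is_upair_def ev_simps ext_iff[of _ "upr _ _"])

lemma ev_is_pair: "z < n \<Longrightarrow> x < n \<Longrightarrow> y < n \<Longrightarrow>
    ev (=) E v n \<rho> (is_pair z x y) \<longleftrightarrow> \<rho> z = pr (\<rho> x) (\<rho> y)"
  by (simp add: is_pair_def ev_simps ev_is_upair pr_def)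

lemma ev_is_suc: "z < n \<Longrightarrow> x < n \<Longrightarrow> ev (=) E v n \<rho> (is_suc z x) \<longleftrightarrow> \<rho> z = suc (\<rho> x)"
  by (simp add: is_suc_def ev_simps ext_iff[of _ "suc _"])

lemma mem_prd [simp]: "p \<in>\<^sub>m prd x y \<longleftrightarrow> (\<exists>a b. a \<in>\<^sub>m x \<and> b \<in>\<^sub>m y \<and> p = pr a b)"
proof -
  have "\<exists>z. \<forall>p. p \<in>\<^sub>m z \<longleftrightarrow> (\<exists>a. a \<in>\<^sub>m x \<and> (\<exists>b. b \<in>\<^sub>m y \<and> p = pr a b))"
    using axiom[of ax_product u]
    by (simp add: EST_def ax_product_def is_prod_def ev_simps ev_is_pair)
  from someI_ex[OF this] show ?thesis unfolding prd_def by blast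
qed

lemma ev_is_prod: "z < n \<Longrightarrow> x < n \<Longrightarrow> y < n \<Longrightarrow>
    ev (=) E v n \<rho> (is_prod z x y) \<longleftrightarrow> \<rho> z = prd (\<rho> x) (\<rho> y)"
  by (simp add: is_prod_def ev_simps ev_is_pair ext_iff[of _ "prd _ _"])

section \<open>Natural numbers of the model and definable induction\<close>

definition is_nat :: "'a \<Rightarrow> bool" where
  "is_nat x \<longleftrightarrow>
     (\<forall>y. y \<in>\<^sub>m x \<longrightarrow> (\<forall>z. z \<in>\<^sub>m y \<longrightarrow> z \<in>\<^sub>m x)) \<and>
     (\<forall>y. y \<in>\<^sub>m x \<longrightarrow> (\<forall>z. z \<in>\<^sub>m x \<longrightarrow> y \<in>\<^sub>m z \<or> y = z \<or> z \<in>\<^sub>m y)) \<and>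
     (\<forall>y. y \<in>\<^sub>m x \<or> y = x \<longrightarrow> y = emp \<or> (\<exists>z. z \<in>\<^sub>m y \<and> y = suc z))"

lemma ev_Nat: "x < n \<Longrightarrow> ev (=) E v n \<rho> (Nat x) \<longleftrightarrow> is_nat (\<rho> x)"
  by (simp add: Nat_def Ord_def Succ_def subset_def ev_simps ev_is_empty ev_is_suc is_nat_def)

lemmas ev_set = ev_simps ev_is_empty ev_is_upair ev_is_pair ev_is_suc ev_is_prod ev_Nat

text \<open>Definability with parameters. As the model may contain nonstandard natural numbers,
  induction is available for such predicates only.\<close>

definition definable :: "('a \<Rightarrow> bool) \<Rightarrow> bool" where
  "definable P \<longleftrightarrow> (\<exists>p e. \<forall>x. P x \<longleftrightarrow> sat (=) E (case_nat x e) p)"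

lemma definable_ev: "definable (\<lambda>x. ev (=) E v (Suc n) (\<rho>(n := x)) F)"
  unfolding definable_def
proof (intro exI allI)
  show "ev (=) E v (Suc n) (\<rho>(n := x)) F \<longleftrightarrow>
      sat (=) E (case_nat x (\<lambda>i. if i < n then \<rho> (n - Suc i) else v (i - n))) (F (Suc n))" for x
    by (simp only: ev_def env_shift)
qed

text \<open>The induction scheme admits only formulas that imply \<open>Nat\<close>, so a definable
  property is first restricted to the natural numbers.\<close>

lemma definable_conj_nat:
  assumes "definable P"
  shows "definable (\<lambda>x. is_nat x \<and> P x)"
proof -
  obtain p e where p: "\<And>x. P x \<longleftrightarrow> sat (=) E (case_nat x e) p"
    using assms unfolding definable_def by blast
  have "sat (=) E (case_nat x e) (Nat 0 (Suc 0)) \<longleftrightarrow> is_nat x" for x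
  proof -
    have "sat (=) E (case_nat x e) (Nat 0 (Suc 0)) \<longleftrightarrow> ev (=) E e (Suc 0) (e(0 := x)) (Nat 0)"
      unfolding ev_def by (rule sat_cong) (auto split: nat.split)
    then show ?thesis by (simp add: ev_Nat)
  qed
  then have "(is_nat x \<and> P x) \<longleftrightarrow>
      sat (=) E (case_nat x e) (Neg (Imp (Nat 0 (Suc 0)) (Neg p)))" for x
    by (simp add: p)
  then show ?thesis unfolding definable_def by blast
qed

lemma fv_bound: "\<exists>k. fv p \<subseteq> {..k}"
  using finite_fv finite_nat_set_iff_bounded_le by (metis atMost_iff subsetI)

text \<open>The scheme is applied to \<open>is_nat x \<and> P x\<close>. Its base and step also
  assert that \<open>emp\<close> and successors are natural numbers, hence the assumptions
  \<open>nat\<close>.\<close>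

lemma nat_induct_definable:
  assumes "definable P" "P emp" "\<And>x. is_nat x \<Longrightarrow> P x \<Longrightarrow> P (suc x)"
    and nat: "is_nat emp" "\<And>x. is_nat x \<Longrightarrow> is_nat (suc x)" and "is_nat x"
  shows "P x"
proof -
  obtain p e where p: "\<And>x. is_nat x \<and> P x \<longleftrightarrow> sat (=) E (case_nat x e) p"
    using definable_conj_nat[OF assms(1)] unfolding definable_def by blast
  obtain k where k: "fv p \<subseteq> {..k}" using fv_bound by blast
  then have "closure k (induction p) \<in> EST \<union> VP" by (auto simp: EST_def)
  then have "sat (=) E u (closure k (induction p))" by (rule model)
  then have "ev (=) E u k e (induction p)" unfolding sat_closure ..
  have app: "ev (=) E v n \<rho> (appL p x) \<longleftrightarrow> is_nat (\<rho> x) \<and> P (\<rho> x)"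
    if "k \<le> n" "x < n" "\<forall>i<k. \<rho> i = e i" for v n \<rho> x
    using ev_appL[OF k, of n x \<rho> e] that by (simp add: p)
  have "ev (=) E u k e (induction p) \<longleftrightarrow>
      (is_nat emp \<and> P emp \<and> (\<forall>x. is_nat x \<longrightarrow> P x \<longrightarrow> is_nat (suc x) \<and> P (suc x)) \<longrightarrow>
      (\<forall>x. is_nat x \<longrightarrow> P x))"
    by (simp add: induction_def ev_set app)
  with \<open>ev (=) E u k e (induction p)\<close> assms(2,3) nat \<open>is_nat x\<close> show ?thesis by blast
qed

lemma is_nat_emp [simp]: "is_nat emp"
  by (simp add: is_nat_def)

lemma is_nat_suc [simp]:
  assumes "is_nat x"
  shows "is_nat (suc x)"
proof -
  have "y = emp \<or> (\<exists>z. z \<in>\<^sub>m y \<and> y = suc z)" if "y \<in>\<^sub>m suc x \<or> y = suc x" for y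
  proof (cases "y = suc x")
    case True
    then show ?thesis by (intro disjI2 exI[of _ x]) simp
  next
    case False
    then have "y \<in>\<^sub>m x \<or> y = x" using that by simp
    then show ?thesis using assms unfolding is_nat_def by blast
  qed
  moreover have "\<forall>y. y \<in>\<^sub>m suc x \<longrightarrow> (\<forall>z. z \<in>\<^sub>m y \<longrightarrow> z \<in>\<^sub>m suc x)"
    using assms by (auto simp: is_nat_def)
  moreover have "\<forall>y. y \<in>\<^sub>m suc x \<longrightarrow> (\<forall>z. z \<in>\<^sub>m suc x \<longrightarrow> y \<in>\<^sub>m z \<or> y = z \<or> z \<in>\<^sub>m y)"
    using assms by (auto simp: is_nat_def)
  ultimately show ?thesis unfolding is_nat_def[of "suc x"] by blast
qed

lemma is_nat_num [simp]: "is_nat (num k)"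
  by (induction k) (auto simp: num_def)

text \<open>The working form of induction: an explicit formula \<open>F\<close> has the induction
  variable at level \<open>n\<close> and its parameters at the levels below.\<close>

lemma nat_induct_ev:
  assumes "is_nat x" "\<And>x. P x \<longleftrightarrow> ev (=) E u (Suc n) (\<rho>(n := x)) F"
    "P emp" "\<And>x. is_nat x \<Longrightarrow> P x \<Longrightarrow> P (suc x)"
  shows "P x"
proof (rule nat_induct_definable[OF _ assms(3,4) is_nat_emp is_nat_suc assms(1)])
  show "definable P" unfolding assms(2) by (rule definable_ev)
qed

lemma nat_mem: "is_nat n \<Longrightarrow> y \<in>\<^sub>m n \<Longrightarrow> is_nat y"
proof -
  assume "is_nat n"
  then have "\<forall>y. y \<in>\<^sub>m n \<longrightarrow> is_nat y"
    by (rule nat_induct_ev[where n = 0 and \<rho> = u and F = "ballL 0 Nat"])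
      (auto simp: ev_set)
  then show "y \<in>\<^sub>m n \<Longrightarrow> is_nat y" by blast
qed

lemma nat_trans: "is_nat n \<Longrightarrow> y \<in>\<^sub>m n \<Longrightarrow> z \<in>\<^sub>m y \<Longrightarrow> z \<in>\<^sub>m n"
  unfolding is_nat_def by blast

text \<open>EST has no axiom of Foundation, so this is proved by induction: \<open>suc x\<close> in
  itself would put \<open>x\<close> into \<open>x\<close> by transitivity.\<close>

lemma nat_irrefl: "is_nat n \<Longrightarrow> \<not> n \<in>\<^sub>m n"
proof (erule nat_induct_ev[where n = 0 and \<rho> = u and F = "\<^bold>\<not> 0 \<^bold>\<in> 0"])
  fix x assume x: "is_nat x" "\<not> x \<in>\<^sub>m x"
  have "x \<in>\<^sub>m suc x" by simp
  then show "\<not> suc x \<in>\<^sub>m suc x" using x nat_trans by (metis mem_suc)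
qed (simp_all add: ev_set)

lemma suc_neq [simp]: "is_nat n \<Longrightarrow> suc n \<noteq> n" "is_nat n \<Longrightarrow> n \<noteq> suc n"
  using nat_irrefl mem_suc by metis+

lemma suc_neq_emp [simp]: "suc n \<noteq> emp" "emp \<noteq> suc n"
  using mem_suc mem_emp by metis+

text \<open>Otherwise \<open>a\<close> and \<open>b\<close> would be elements of each other, and
  transitivity of \<open>a\<close> would give \<open>a\<close> as an element of itself.\<close>

lemma suc_inject: "is_nat a \<Longrightarrow> suc a = suc b \<Longrightarrow> a = b"
  by (metis mem_suc nat_irrefl nat_trans)

lemma num_simps: "num 0 = emp" "num (Suc k) = suc (num k)"
  by (simp_all add: num_def)

lemma num_eq_iff [simp]: "num i = num j \<longleftrightarrow> i = j"
proof (induction i arbitrary: j)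
  case 0
  then show ?case by (cases j) (simp_all add: num_simps)
next
  case (Suc i)
  then show ?case by (cases j) (auto simp: num_simps dest: suc_inject[OF is_nat_num])
qed

lemma emp_mem: "is_nat n \<Longrightarrow> n \<noteq> emp \<Longrightarrow> emp \<in>\<^sub>m n"
proof -
  assume "is_nat n"
  then have "n = emp \<or> emp \<in>\<^sub>m n"
    by (rule nat_induct_ev[where n = 0 and \<rho> = u and
          F = "\<^bold>\<exists>e. is_empty e \<^bold>\<and> (0 \<^bold>= e \<^bold>\<or> e \<^bold>\<in> 0)"])
      (auto simp: ev_set)
  then show "n \<noteq> emp \<Longrightarrow> emp \<in>\<^sub>m n" by blast
qed

lemma suc_mem_suc: "is_nat n \<Longrightarrow> k \<in>\<^sub>m n \<Longrightarrow> suc k \<in>\<^sub>m suc n"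
proof -
  assume "is_nat n"
  then have "\<forall>k. k \<in>\<^sub>m n \<longrightarrow> suc k \<in>\<^sub>m suc n"
    by (rule nat_induct_ev[where n = 0 and \<rho> = u and
          F = "ballL 0 (\<lambda>k. \<^bold>\<forall>j. is_suc j k \<^bold>\<longrightarrow> (\<^bold>\<forall>m. is_suc m 0 \<^bold>\<longrightarrow> j \<^bold>\<in> m))"])
      (auto simp: ev_set simp del: mem_suc, auto)
  then show "k \<in>\<^sub>m n \<Longrightarrow> suc k \<in>\<^sub>m suc n" by blast
qed

lemma mem_if_suc_mem_suc: "is_nat n \<Longrightarrow> suc k \<in>\<^sub>m suc n \<Longrightarrow> k \<in>\<^sub>m n"
  using nat_trans[of n "suc k" k] by auto

text \<open>Internal induction builds the set one pair at a time, the step adding the pair that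
  starts at the new last element.\<close>

lemma successor_graph_exists:
  assumes "is_nat n"
  shows "\<exists>S. \<forall>p. p \<in>\<^sub>m S \<longleftrightarrow> (\<exists>k. k \<in>\<^sub>m n \<and> p = pr k (suc k))"
  using assms
proof (rule nat_induct_ev[where n = 0 and \<rho> = u and
      F = "\<^bold>\<exists>S. \<^bold>\<forall>p. p \<^bold>\<in> S \<^bold>\<longleftrightarrow> bexL 0 (\<lambda>k. \<^bold>\<exists>j. is_suc j k \<^bold>\<and> is_pair p k j)"])
  fix x assume "\<exists>S. \<forall>p. p \<in>\<^sub>m S \<longleftrightarrow> (\<exists>k. k \<in>\<^sub>m x \<and> p = pr k (suc k))"
  then obtain S where "\<forall>p. p \<in>\<^sub>m S \<longleftrightarrow> (\<exists>k. k \<in>\<^sub>m x \<and> p = pr k (suc k))" ..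
  then show "\<exists>S. \<forall>p. p \<in>\<^sub>m S \<longleftrightarrow> (\<exists>k. k \<in>\<^sub>m suc x \<and> p = pr k (suc k))"
    by (intro exI[of _ "ins (pr x (suc x)) S"]) auto
qed (auto simp: ev_set intro: exI[of _ emp])

text \<open>The same pairs coded as members of the iterated product \<open>M\<^sup>2\<close>; they
  will form the bulk of the set of assignments satisfying \<open>R(v_0, v_1)\<close>.\<close>

lemma successor_tuples_exist:
  assumes "is_nat n"
  shows "\<exists>S. \<forall>p. p \<in>\<^sub>m S \<longleftrightarrow> (\<exists>k. k \<in>\<^sub>m n \<and> p = pr (pr emp k) (suc k))"
  using assms
proof (rule nat_induct_ev[where n = 0 and \<rho> = u and
      F = "\<^bold>\<exists>S. \<^bold>\<forall>p. p \<^bold>\<in> S \<^bold>\<longleftrightarrow> bexL 0 (\<lambda>k. \<^bold>\<exists>e. \<^bold>\<exists>t. \<^bold>\<exists>j.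
        is_empty e \<^bold>\<and> is_pair t e k \<^bold>\<and> is_suc j k \<^bold>\<and> is_pair p t j)"])
  fix x assume "\<exists>S. \<forall>p. p \<in>\<^sub>m S \<longleftrightarrow> (\<exists>k. k \<in>\<^sub>m x \<and> p = pr (pr emp k) (suc k))"
  then obtain S where "\<forall>p. p \<in>\<^sub>m S \<longleftrightarrow> (\<exists>k. k \<in>\<^sub>m x \<and> p = pr (pr emp k) (suc k))" ..
  then show "\<exists>S. \<forall>p. p \<in>\<^sub>m S \<longleftrightarrow> (\<exists>k. k \<in>\<^sub>m suc x \<and> p = pr (pr emp k) (suc k))"
    by (intro exI[of _ "ins (pr (pr emp x) (suc x)) S"]) auto
qed (auto simp: ev_set intro: exI[of _ emp])


section \<open>Satisfaction of an atomic formula\<close>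

definition fun_on :: "'a \<Rightarrow> 'a \<Rightarrow> bool" where
  "fun_on f d \<longleftrightarrow>
     (\<forall>p. p \<in>\<^sub>m f \<longrightarrow> (\<exists>x. x \<in>\<^sub>m d \<and> (\<exists>y. p = pr x y))) \<and>
     (\<forall>x. x \<in>\<^sub>m d \<longrightarrow> (\<exists>y. pr x y \<in>\<^sub>m f \<and> (\<forall>z. pr x z \<in>\<^sub>m f \<longrightarrow> z = y)))"

definition quad :: "'a \<Rightarrow> 'a \<Rightarrow> 'a \<Rightarrow> 'a \<Rightarrow> 'a" where
  "quad x y z w = pr (pr (pr x y) z) w"

lemma ev_app: "f < n \<Longrightarrow> x < n \<Longrightarrow> y < n \<Longrightarrow>
    ev (=) E v n \<rho> (app f x y) \<longleftrightarrow> pr (\<rho> x) (\<rho> y) \<in>\<^sub>m \<rho> f"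
  by (simp add: app_def ev_set)

lemma ev_fun_dom: "f < n \<Longrightarrow> d < n \<Longrightarrow> ev (=) E v n \<rho> (fun_dom f d) \<longleftrightarrow> fun_on (\<rho> f) (\<rho> d)"
  by (simp add: fun_dom_def fun_on_def ev_set ev_app)

lemma ev_is_num: "x < n \<Longrightarrow> ev (=) E v n \<rho> (is_num k x) \<longleftrightarrow> \<rho> x = num k"
  by (induction k arbitrary: n \<rho> x) (simp_all add: ev_set num_simps)

lemma ev_tag1: "z < n \<Longrightarrow> x < n \<Longrightarrow> ev (=) E v n \<rho> (tag1 k z x) \<longleftrightarrow> \<rho> z = pr (num k) (\<rho> x)"
  by (simp add: tag1_def ev_set ev_is_num)

lemma ev_tag2: "z < n \<Longrightarrow> x < n \<Longrightarrow> y < n \<Longrightarrow>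
    ev (=) E v n \<rho> (tag2 k z x y) \<longleftrightarrow> \<rho> z = pr (num k) (pr (\<rho> x) (\<rho> y))"
  by (simp add: tag2_def ev_set ev_tag1)

lemma ev_is_quad: "q < n \<Longrightarrow> x < n \<Longrightarrow> y < n \<Longrightarrow> z < n \<Longrightarrow> w < n \<Longrightarrow>
    ev (=) E v n \<rho> (is_quad q x y z w) \<longleftrightarrow> \<rho> q = quad (\<rho> x) (\<rho> y) (\<rho> z) (\<rho> w)"
  by (simp add: is_quad_def quad_def ev_set)

lemmas code_defs = c_var_def c_const_def c_eq_def c_U_def c_R_def c_neg_def c_and_def c_ex_def

lemmas ev_code = ev_set ev_app ev_fun_dom ev_tag1 ev_tag2 ev_is_quad

lemma fun_on_emp: "fun_on emp emp"
  by (simp add: fun_on_def)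

lemma fun_on_ins:
  assumes "fun_on f d" "\<not> x \<in>\<^sub>m d"
  shows "fun_on (ins (pr x y) f) (ins x d)"
  unfolding fun_on_def
proof (intro conjI allI impI)
  fix p assume "p \<in>\<^sub>m ins (pr x y) f"
  then show "\<exists>a. a \<in>\<^sub>m ins x d \<and> (\<exists>b. p = pr a b)"
    using assms(1) unfolding fun_on_def mem_ins by blast
next
  fix a assume "a \<in>\<^sub>m ins x d"
  moreover have "\<not> pr x z \<in>\<^sub>m f" for z
    using assms unfolding fun_on_def by force
  ultimately show "\<exists>b. pr a b \<in>\<^sub>m ins (pr x y) f \<and> (\<forall>z. pr a z \<in>\<^sub>m ins (pr x y) f \<longrightarrow> z = b)"
    using assms unfolding fun_on_def by (cases "a = x") auto
qed

lemma fun_on_unique: "fun_on f d \<Longrightarrow> pr x y \<in>\<^sub>m f \<Longrightarrow> pr x z \<in>\<^sub>m f \<Longrightarrow> y = z"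
proof -
  assume f: "fun_on f d" and y: "pr x y \<in>\<^sub>m f" and z: "pr x z \<in>\<^sub>m f"
  have "x \<in>\<^sub>m d" using f y unfolding fun_on_def by force
  then obtain w where "\<And>z. pr x z \<in>\<^sub>m f \<Longrightarrow> z = w" using f unfolding fun_on_def by blast
  with y z show "y = z" by blast
qed

lemma mem_num: "\<not> x \<in>\<^sub>m num 0" "x \<in>\<^sub>m num (Suc 0) \<longleftrightarrow> x = num 0"
  "x \<in>\<^sub>m num 2 \<longleftrightarrow> x = num 0 \<or> x = num (Suc 0)"
  by (auto simp: num_simps numeral_2_eq_2)

lemma fun_on_num1: "fun_on (ins (pr (num 0) a) emp) (num (Suc 0))"
  using fun_on_ins[OF fun_on_emp, of "num 0" a] by (simp add: num_simps suc_def)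

lemma suc_num: "suc (num 0) = num (Suc 0)" "suc (num (Suc 0)) = num 2" "suc (num 2) = num 3"
  by (simp_all add: num_simps eval_nat_numeral)

lemma fun_on_num3:
  "fun_on (ins (pr (num 2) c) (ins (pr (num (Suc 0)) b) (ins (pr (num 0) a) emp))) (num 3)"
proof -
  have "fun_on (ins (pr (num 2) c) (ins (pr (num (Suc 0)) b) (ins (pr (num 0) a) emp)))
      (ins (num 2) (ins (num (Suc 0)) (ins (num 0) emp)))"
    by (intro fun_on_ins fun_on_emp) simp_all
  moreover have "ins (num 2) (ins (num (Suc 0)) (ins (num 0) emp)) = num 3"
    unfolding suc_num(3)[symmetric] by (rule extensionality) (auto simp: mem_num)
  ultimately show ?thesis by simp
qed

section \<open>Coordinates, terms and the satisfaction sequence of one formula\<close>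

definition coordinate :: "'a \<Rightarrow> 'a \<Rightarrow> 'a \<Rightarrow> 'a \<Rightarrow> bool" where
  "coordinate x n k a \<longleftrightarrow> k \<in>\<^sub>m n \<and> (\<exists>t. fun_on t (suc n) \<and> pr n x \<in>\<^sub>m t \<and>
     (\<forall>i. i \<in>\<^sub>m n \<longrightarrow> (\<exists>y b. pr i y \<in>\<^sub>m t \<and> pr (suc i) (pr y b) \<in>\<^sub>m t \<and> (i = k \<longrightarrow> b = a))))"

lemma ev_coord:
  assumes "x < n" "m < n" "k < n" "a < n"
  shows "ev (=) E v n \<rho> (coord x m k a) \<longleftrightarrow> coordinate (\<rho> x) (\<rho> m) (\<rho> k) (\<rho> a)"
proof -
  have "(\<exists>z. P z \<and> (\<exists>b. z = pr y b \<and> Q b)) \<longleftrightarrow> (\<exists>b. P (pr y b) \<and> Q b)" for P Q y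
    by blast
  with assms show ?thesis by (simp add: coord_def coordinate_def ev_code)
qed

text \<open>A witnessing sequence runs through \<open>y\<close>, \<open>pr y b\<close> and
  \<open>pr (pr y b) c\<close>. The innermost \<open>y\<close> is arbitrary, since
  \<open>coord\<close> does not require the empty tuple there; membership in the power of the
  universe does.\<close>

lemma coordinate_num2:
  "coordinate x (num 2) k a \<longleftrightarrow>
     (\<exists>y b c. x = pr (pr y b) c \<and> (k = num 0 \<and> a = b \<or> k = num (Suc 0) \<and> a = c))"
    (is "_ \<longleftrightarrow> ?R")
proof
  assume "coordinate x (num 2) k a"
  then obtain t where k: "k = num 0 \<or> k = num (Suc 0)" and t: "fun_on t (suc (num 2))" "pr (num 2) x \<in>\<^sub>m t"
    and *: "\<And>i. i = num 0 \<or> i = num (Suc 0) \<Longrightarrow>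
      \<exists>y b. pr i y \<in>\<^sub>m t \<and> pr (suc i) (pr y b) \<in>\<^sub>m t \<and> (i = k \<longrightarrow> b = a)"
    unfolding coordinate_def mem_num by metis
  obtain y b where b: "pr (num (Suc 0)) (pr y b) \<in>\<^sub>m t" "num 0 = k \<longrightarrow> b = a"
    using *[of "num 0"] by (auto simp: suc_num)
  obtain z c where c: "pr (num (Suc 0)) z \<in>\<^sub>m t" "pr (num 2) (pr z c) \<in>\<^sub>m t" "num (Suc 0) = k \<longrightarrow> c = a"
    using *[of "num (Suc 0)"] by (auto simp: suc_num)
  have "z = pr y b" "x = pr z c"
    using fun_on_unique[OF t(1)] b c t(2) by blast+
  then show ?R using k b c by blast
next
  assume ?R
  then obtain y b c where x: "x = pr (pr y b) c"
    and k: "k = num 0 \<and> a = b \<or> k = num (Suc 0) \<and> a = c" by blast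
  let ?t = "ins (pr (num 2) x) (ins (pr (num (Suc 0)) (pr y b)) (ins (pr (num 0) y) emp))"
  have "fun_on ?t (suc (num 2))" using fun_on_num3 by (simp add: suc_num)
  moreover have "pr (num 2) x \<in>\<^sub>m ?t" by simp
  moreover have "\<exists>y b. pr i y \<in>\<^sub>m ?t \<and> pr (suc i) (pr y b) \<in>\<^sub>m ?t \<and> (i = k \<longrightarrow> b = a)"
    if "i \<in>\<^sub>m num 2" for i
  proof (cases "i = num 0")
    case True
    then show ?thesis using k by (intro exI[of _ y] exI[of _ b]) (auto simp: suc_num)
  next
    case False
    then have "i = num (Suc 0)" using that by (simp add: mem_num)
    then show ?thesis using k by (intro exI[of _ "pr y b"] exI[of _ c]) (auto simp: suc_num x)
  qed
  moreover have "k \<in>\<^sub>m num 2" using k by (auto simp: mem_num)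
  ultimately show "coordinate x (num 2) k a" unfolding coordinate_def by blast
qed

text \<open>The code of the formula \<open>R(v_0, v_1)\<close>, the only one that the proof evaluates.\<close>

definition code_R01 :: 'a where
  "code_R01 = pr (num 4) (pr (pr (num 0) (num 0)) (pr (num 0) (num (Suc 0))))"

definition term_val :: "'a \<Rightarrow> 'a \<Rightarrow> 'a \<Rightarrow> 'a \<Rightarrow> 'a \<Rightarrow> bool" where
  "term_val I n x t a \<longleftrightarrow> (\<exists>c. t = pr (num 1) c \<and> pr c a \<in>\<^sub>m I) \<or>
     (\<exists>k. k \<in>\<^sub>m n \<and> t = pr (num 0) k \<and> coordinate x n k a)"

lemma ev_val: "I < n \<Longrightarrow> m < n \<Longrightarrow> x < n \<Longrightarrow> t < n \<Longrightarrow> a < n \<Longrightarrow>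
    ev (=) E v n \<rho> (val I m x t a) \<longleftrightarrow> term_val (\<rho> I) (\<rho> m) (\<rho> x) (\<rho> t) (\<rho> a)"
  by (simp add: val_def term_val_def code_defs ev_code ev_coord)

lemma term_val_num2:
  "term_val I (num 2) x (pr (num 0) (num 0)) a \<longleftrightarrow> (\<exists>y c. x = pr (pr y a) c)"
  "term_val I (num 2) x (pr (num 0) (num (Suc 0))) a \<longleftrightarrow> (\<exists>y b. x = pr (pr y b) a)"
  by (auto simp: term_val_def coordinate_num2 mem_num)

text \<open>An atomic formula has a formation sequence of length one, whose last index is
  \<open>num 0\<close>.\<close>

lemma ev_Formula_R01:
  assumes "A < n" "z < n" "\<rho> z = code_R01"
  shows "ev (=) E v n \<rho> (Formula A z)"
proof -
  let ?s = "ins (pr (num 0) code_R01) emp"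
  have "ev (=) E v n \<rho> (Formula A z) \<longleftrightarrow> (\<exists>s m.
      ev (=) E v (Suc (Suc (Suc n))) (\<rho>(n := suc m, Suc n := s, Suc (Suc n) := m))
        (formation A n (Suc n)) \<and> pr m code_R01 \<in>\<^sub>m s)"
    using assms by (auto simp: Formula_def ev_code)
  moreover have "ev (=) E v (Suc (Suc (Suc n)))
      (\<rho>(n := suc (num 0), Suc n := ?s, Suc (Suc n) := num 0)) (formation A n (Suc n))"
    using assms(1) fun_on_num1
    by (auto simp: formation_def Term_def Var_def code_defs code_R01_def ev_code suc_num mem_num)
  moreover have "pr (num 0) code_R01 \<in>\<^sub>m ?s" by simp
  ultimately show ?thesis by blast
qed

lemma ev_sat_seq_R01_I:
  assumes "A < n" "U < n" "R < n" "I < n" "m < n" "X < n" "d < n" "s < n" "S < n"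
    and "\<rho> m = num 2" "\<rho> d = num (Suc 0)"
    "\<rho> s = ins (pr (num 0) code_R01) emp" "\<rho> S = ins (pr (num 0) Y) emp"
    and Y: "\<And>x. x \<in>\<^sub>m Y \<longleftrightarrow> x \<in>\<^sub>m \<rho> X \<and> (\<exists>y a b. x = pr (pr y a) b \<and> pr a b \<in>\<^sub>m \<rho> R)"
  shows "ev (=) E v n \<rho> (sat_seq A U R I m X d s S)"
  using assms(1-9) fun_on_num1
  by (auto simp: assms(10-13) sat_seq_def is_Sep_def Term_below_def code_R01_def
      code_defs ev_code ev_val mem_num term_val_num2 Y)

text \<open>The sequence may have any length, but only its clause at \<open>i\<close> is inspected.
  The tag \<open>num 4\<close> of the code differs from the tags of all other disjuncts, which
  leaves Tarski's clause for \<open>R\<close>.\<close>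

lemma ev_sat_seq_R01_D:
  assumes "A < n" "U < n" "R < n" "I < n" "m < n" "X < n" "d < n" "s < n" "S < n"
    and "ev (=) E v n \<rho> (sat_seq A U R I m X d s S)"
    and "\<rho> m = num 2" "i \<in>\<^sub>m \<rho> d" "pr i code_R01 \<in>\<^sub>m \<rho> s" "pr i Y \<in>\<^sub>m \<rho> S" "x \<in>\<^sub>m Y"
  shows "\<exists>y a b. x = pr (pr y a) b \<and> pr a b \<in>\<^sub>m \<rho> R"
proof -
  have s: "fun_on (\<rho> s) (\<rho> d)" and S: "fun_on (\<rho> S) (\<rho> d)"
    using assms(1-10) by (simp_all add: sat_seq_def ev_code)
  have s_i: "pr i z \<in>\<^sub>m \<rho> s \<longleftrightarrow> z = code_R01" and S_i: "pr i Z \<in>\<^sub>m \<rho> S \<longleftrightarrow> Z = Y" for z Z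
    using fun_on_unique s S assms(13,14) by blast+
  show ?thesis
    using assms(10) unfolding sat_seq_def
    apply (simp only: ev_and ev_ball assms(7))
    apply (elim conjE, drule spec[of _ i], drule mp, rule assms(12))
    using assms(1-9,15)
    by (auto simp: assms(11) s_i S_i is_Sep_def Term_below_def code_R01_def code_defs ev_code
        ev_val term_val_num2)
qed


text \<open>The last condition says that the set of pairs satisfying \<open>R(v_0, v_1)\<close> exists.\<close>

definition binary_structure :: "'a \<Rightarrow> 'a \<Rightarrow> bool" where
  "binary_structure M R \<longleftrightarrow> M \<noteq> emp \<and>
     (\<forall>p. p \<in>\<^sub>m R \<longrightarrow> (\<exists>a. a \<in>\<^sub>m M \<and> (\<exists>b. b \<in>\<^sub>m M \<and> p = pr a b))) \<and>
     (\<exists>Y. \<forall>x. x \<in>\<^sub>m Y \<longleftrightarrow> (\<exists>a b. pr a b \<in>\<^sub>m R \<and> x = pr (pr emp a) b))"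

section \<open>From elementary embeddings to injective homomorphisms\<close>

text \<open>The part of elementarity used for rigidity: an injective homomorphism.\<close>

definition embedding :: "'a \<Rightarrow> 'a \<Rightarrow> 'a \<Rightarrow> 'a \<Rightarrow> 'a \<Rightarrow> bool" where
  "embedding f M R N Q \<longleftrightarrow> fun_on f M \<and>
     (\<forall>x y. pr x y \<in>\<^sub>m f \<longrightarrow> y \<in>\<^sub>m N) \<and>
     (\<forall>x y z. pr x z \<in>\<^sub>m f \<longrightarrow> pr y z \<in>\<^sub>m f \<longrightarrow> x = y) \<and>
     (\<forall>a b a' b'. pr a b \<in>\<^sub>m R \<longrightarrow> pr a a' \<in>\<^sub>m f \<longrightarrow> pr b b' \<in>\<^sub>m f \<longrightarrow> pr a' b' \<in>\<^sub>m Q)"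

text \<open>The value of \<open>is_power\<close> for exponent two, starting from the singleton of
  the empty tuple.\<close>

definition square :: "'a \<Rightarrow> 'a" where
  "square M = prd (prd (upr emp emp) M) M"

lemma mem_square: "x \<in>\<^sub>m square M \<longleftrightarrow> (\<exists>a b. a \<in>\<^sub>m M \<and> b \<in>\<^sub>m M \<and> x = pr (pr emp a) b)"
  unfolding square_def mem_prd mem_upr by blast

lemma ev_is_power_num2:
  assumes "X < n" "M < n" "m < n" "\<rho> m = num 2" "\<rho> X = square (\<rho> M)"
  shows "ev (=) E v n \<rho> (is_power X M m)"
proof -
  \<comment> \<open>The sequence of the powers with exponents zero, one and two.\<close>
  let ?P = "ins (pr (num 2) (\<rho> X)) (ins (pr (num (Suc 0)) (prd (upr emp emp) (\<rho> M)))
      (ins (pr (num 0) (upr emp emp)) emp))"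
  have "\<exists>Y. pr i Y \<in>\<^sub>m ?P \<and> pr (suc i) (prd Y (\<rho> M)) \<in>\<^sub>m ?P" if "i \<in>\<^sub>m num 2" for i
  proof (cases "i = num 0")
    case True
    then show ?thesis by (intro exI[of _ "upr emp emp"]) (simp add: suc_num)
  next
    case False
    then have "i = num (Suc 0)" using that by (simp add: mem_num)
    then show ?thesis
      by (intro exI[of _ "prd (upr emp emp) (\<rho> M)"]) (simp add: suc_num assms square_def)
  qed
  moreover have "fun_on ?P (suc (num 2))" using fun_on_num3 by (simp add: suc_num)
  moreover have "pr emp (upr emp emp) \<in>\<^sub>m ?P" by (simp add: num_simps)
  moreover have "pr (num 2) (\<rho> X) \<in>\<^sub>m ?P" by simp
  ultimately have "\<exists>P. fun_on P (suc (num 2)) \<and> pr emp (upr emp emp) \<in>\<^sub>m P \<and>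
      (\<forall>i. i \<in>\<^sub>m num 2 \<longrightarrow> (\<exists>Y. pr i Y \<in>\<^sub>m P \<and> pr (suc i) (prd Y (\<rho> M)) \<in>\<^sub>m P)) \<and>
      pr (num 2) (\<rho> X) \<in>\<^sub>m P"
    by blast
  then show ?thesis using assms(1-4) by (simp add: is_power_def ev_code)
qed

lemma ev_maps_tuple_num2:
  assumes "f < n" "m < n" "x < n" "y < n" "\<rho> m = num 2"
    and "\<rho> x = pr (pr emp a) b" "\<rho> y = pr (pr emp a') b'" "pr a a' \<in>\<^sub>m \<rho> f" "pr b b' \<in>\<^sub>m \<rho> f"
  shows "ev (=) E v n \<rho> (maps_tuple f m x y)"
  using assms by (auto simp: maps_tuple_def ev_code ev_coord coordinate_num2 mem_num)

lemma ev_Sat_R01_I: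
  assumes lt: "A < n" "M < n" "U < n" "R < n" "I < n" "z < n" "m < n" "x < n"
    and m: "\<rho> m = num 2" and z: "\<rho> z = code_R01" and R: "binary_structure (\<rho> M) (\<rho> R)"
    and ab: "pr a b \<in>\<^sub>m \<rho> R" and x: "\<rho> x = pr (pr emp a) b"
  shows "ev (=) E v n \<rho> (Sat A M U R I z m x)"
proof -
  obtain Y where Y: "\<And>x. x \<in>\<^sub>m Y \<longleftrightarrow> (\<exists>a b. pr a b \<in>\<^sub>m \<rho> R \<and> x = pr (pr emp a) b)"
    using R unfolding binary_structure_def by blast
  have RM: "a \<in>\<^sub>m \<rho> M" "b \<in>\<^sub>m \<rho> M" if "pr a b \<in>\<^sub>m \<rho> R" for a b
    using R that unfolding binary_structure_def by force+
  \<comment> \<open>Tarski's clause leaves the innermost component \<open>y\<close> open; membership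
    in the square forces it to be \<open>emp\<close>.\<close>
  have Y_iff: "x \<in>\<^sub>m Y \<longleftrightarrow> x \<in>\<^sub>m square (\<rho> M) \<and> (\<exists>y a b. x = pr (pr y a) b \<and> pr a b \<in>\<^sub>m \<rho> R)" for x
    unfolding Y mem_square using RM by auto
  let ?s = "ins (pr (num 0) code_R01) emp" and ?S = "ins (pr (num 0) Y) emp"
  \<comment> \<open>The six quantifiers of \<open>Sat\<close> open the levels from \<open>n\<close>
    on; \<open>?\<sigma>\<close> puts the witnesses for \<open>X\<close>, \<open>d\<close>,
    \<open>m\<close>, \<open>s\<close>, \<open>S\<close> and \<open>Y\<close> there.\<close>
  let ?k = "Suc (Suc (Suc (Suc (Suc (Suc n)))))"
  let ?\<sigma> = "\<rho>(n := square (\<rho> M), Suc n := num (Suc 0), Suc (Suc n) := num 0,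
      Suc (Suc (Suc n)) := ?s, Suc (Suc (Suc (Suc n))) := ?S, Suc (Suc (Suc (Suc (Suc n)))) := Y)"
  have "ev (=) E v ?k ?\<sigma> (is_power n M m)"
    by (rule ev_is_power_num2) (use lt m in simp_all)
  moreover have "ev (=) E v ?k ?\<sigma>
      (sat_seq A U R I m n (Suc n) (Suc (Suc (Suc n))) (Suc (Suc (Suc (Suc n)))))"
    by (rule ev_sat_seq_R01_I[where Y = Y]) (use lt m Y_iff in simp_all)
  moreover have "\<rho> x \<in>\<^sub>m Y" using Y ab x by auto
  then have "ev (=) E v ?k ?\<sigma> (is_suc (Suc n) (Suc (Suc n)))"
    "ev (=) E v ?k ?\<sigma> (app (Suc (Suc (Suc n))) (Suc (Suc n)) z)"
    "ev (=) E v ?k ?\<sigma> (app (Suc (Suc (Suc (Suc n)))) (Suc (Suc n)) (Suc (Suc (Suc (Suc (Suc n))))))"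
    "ev (=) E v ?k ?\<sigma> (x \<^bold>\<in> Suc (Suc (Suc (Suc (Suc n)))))"
    using lt z by (simp_all add: ev_code suc_num)
  ultimately show ?thesis
    unfolding Sat_def ev_ex ev_and by blast
qed

lemma ev_Sat_R01_D:
  assumes lt: "A < n" "M < n" "U < n" "R < n" "I < n" "z < n" "m < n" "x < n"
    and m: "\<rho> m = num 2" and z: "\<rho> z = code_R01"
    and "ev (=) E v n \<rho> (Sat A M U R I z m x)"
  shows "\<exists>y a b. \<rho> x = pr (pr y a) b \<and> pr a b \<in>\<^sub>m \<rho> R"
  using assms(11) unfolding Sat_def ev_ex ev_and
proof (elim exE conjE)
  fix X d i s S Y
  let ?k = "Suc (Suc (Suc (Suc (Suc (Suc n)))))"
  let ?\<sigma> = "\<rho>(n := X, Suc n := d, Suc (Suc n) := i, Suc (Suc (Suc n)) := s,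
      Suc (Suc (Suc (Suc n))) := S, Suc (Suc (Suc (Suc (Suc n)))) := Y)"
  assume seq: "ev (=) E v ?k ?\<sigma>
      (sat_seq A U R I m n (Suc n) (Suc (Suc (Suc n))) (Suc (Suc (Suc (Suc n)))))"
    and "ev (=) E v ?k ?\<sigma> (is_suc (Suc n) (Suc (Suc n)))"
    "ev (=) E v ?k ?\<sigma> (app (Suc (Suc (Suc n))) (Suc (Suc n)) z)"
    "ev (=) E v ?k ?\<sigma> (app (Suc (Suc (Suc (Suc n)))) (Suc (Suc n)) (Suc (Suc (Suc (Suc (Suc n))))))"
    "ev (=) E v ?k ?\<sigma> (x \<^bold>\<in> Suc (Suc (Suc (Suc (Suc n)))))"
  then have "d = suc i" "pr i code_R01 \<in>\<^sub>m s" "pr i Y \<in>\<^sub>m S" "\<rho> x \<in>\<^sub>m Y"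
    using lt z by (simp_all add: ev_code)
  then have "\<exists>y a b. \<rho> x = pr (pr y a) b \<and> pr a b \<in>\<^sub>m ?\<sigma> R"
    by (intro ev_sat_seq_R01_D[OF _ _ _ _ _ _ _ _ _ seq, of i Y]) (use lt m in simp_all)
  then show ?thesis using lt by simp
qed

text \<open>Preservation is evaluated for the single formula \<open>R(v_0, v_1)\<close> at pairs,
  from left to right. The set of satisfying pairs must exist in the source structure, hence
  \<open>binary_structure M R\<close>.\<close>

lemma ev_elem_emb_D:
  assumes lt: "A < n" "f < n" "q < n" "r < n"
    and q: "\<rho> q = quad M U R I" and r: "\<rho> r = quad N V Q J" and R: "binary_structure M R"
    and "ev (=) E v n \<rho> (elem_emb A f q r)"
  shows "embedding (\<rho> f) M R N Q"
  using assms(8) unfolding elem_emb_def ev_ex ev_and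
proof (elim exE conjE, goal_cases)
  case (1 M' U' R' I' N' V' Q' J')
  \<comment> \<open>Quadruples determine their components, so the structures unpacked by
    \<open>elem_emb\<close> are the given ones.\<close>
  have eq: "M' = M" "U' = U" "R' = R" "I' = I" "N' = N" "V' = V" "Q' = Q" "J' = J"
    using 1(1,2) lt q r unfolding is_struct_def ev_and by (simp_all add: ev_code quad_def)
  have f: "fun_on (\<rho> f) M" "\<forall>x y. pr x y \<in>\<^sub>m \<rho> f \<longrightarrow> y \<in>\<^sub>m N"
    using 1(3) lt by (simp_all add: fun_into_def ev_code eq)
  have inj: "\<forall>x y z. pr x z \<in>\<^sub>m \<rho> f \<longrightarrow> pr y z \<in>\<^sub>m \<rho> f \<longrightarrow> x = y"
    using 1(4) lt by (simp add: injective_def ev_code) blast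
  have "pr a' b' \<in>\<^sub>m Q" if ab: "pr a b \<in>\<^sub>m R" "pr a a' \<in>\<^sub>m \<rho> f" "pr b b' \<in>\<^sub>m \<rho> f" for a b a' b'
  proof -
    have ab_mem: "a \<in>\<^sub>m M" "b \<in>\<^sub>m M" using R ab(1) unfolding binary_structure_def by force+
    have ab'_mem: "a' \<in>\<^sub>m N" "b' \<in>\<^sub>m N" using f ab by blast+
    note H = 1(5)[unfolded ev_all eq, THEN spec[of _ code_R01], THEN spec[of _ "num 2"],
        THEN spec[of _ "square M"], THEN spec[of _ "square N"],
        THEN spec[of _ "pr (pr emp a) b"], THEN spec[of _ "pr (pr emp a') b'"],
        unfolded ev_imp ev_iff ev_and]
    \<comment> \<open>Levels \<open>n\<close> to \<open>n + 3\<close> hold the components of the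
      source and levels \<open>n + 4\<close> to \<open>n + 7\<close> those of the target, which
      fixes the arguments of \<open>Sat\<close> in \<open>S1\<close> and \<open>S2\<close>.\<close>
    have S1: "ev (=) E v k \<sigma> (Sat A n (Suc n) (Suc (Suc n)) (Suc (Suc (Suc n))) z m x)"
      if "Suc (Suc (Suc n)) < k" "z < k" "m < k" "x < k" "\<sigma> m = num 2" "\<sigma> z = code_R01"
        "\<sigma> n = M" "\<sigma> (Suc (Suc n)) = R" "\<sigma> x = pr (pr emp a) b" for k \<sigma> z m x
      by (rule ev_Sat_R01_I[where a = a and b = b]) (use that lt R ab in simp_all)
    have S2: "pr a' b' \<in>\<^sub>m Q"
      if "ev (=) E v k \<sigma> (Sat A (Suc (Suc (Suc (Suc n)))) (Suc (Suc (Suc (Suc (Suc n)))))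
          (Suc (Suc (Suc (Suc (Suc (Suc n)))))) (Suc (Suc (Suc (Suc (Suc (Suc (Suc n))))))) z m y)"
        "Suc (Suc (Suc (Suc (Suc (Suc (Suc n)))))) < k" "z < k" "m < k" "y < k"
        "\<sigma> m = num 2" "\<sigma> z = code_R01"
        "\<sigma> (Suc (Suc (Suc (Suc (Suc (Suc n)))))) = Q" "\<sigma> y = pr (pr emp a') b'" for k \<sigma> z m y
      using ev_Sat_R01_D[OF _ _ _ _ _ _ _ _ _ _ that(1)] that lt by simp
    show ?thesis
      by (rule S2[OF H[THEN mp, THEN iffD1]])
        (use lt ab in \<open>simp_all add: ev_Formula_R01 ev_is_power_num2 ev_mem mem_square ab_mem ab'_mem
          ev_maps_tuple_num2[where a = a and b = b and a' = a' and b' = b'] S1\<close>)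
  qed
  with f inj show ?case unfolding embedding_def by blast
qed


section \<open>Vopenka's principle for structures with one binary relation\<close>

lemma ev_Struct_I:
  assumes "A < n" "q < n" "\<rho> A = emp" "\<rho> q = quad M emp R emp" "binary_structure M R"
  shows "ev (=) E v n \<rho> (Struct A q)"
proof -
  have "\<exists>M' U' R' I'. \<rho> q = quad M' U' R' I' \<and> M' \<noteq> emp \<and> (\<forall>x. x \<in>\<^sub>m U' \<longrightarrow> x \<in>\<^sub>m M') \<and>
      (\<forall>p. p \<in>\<^sub>m R' \<longrightarrow> (\<exists>a. a \<in>\<^sub>m M' \<and> (\<exists>b. b \<in>\<^sub>m M' \<and> p = pr a b))) \<and>
      fun_on I' (\<rho> A) \<and> (\<forall>x y. pr x y \<in>\<^sub>m I' \<longrightarrow> y \<in>\<^sub>m M')"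
    using assms(3-5) fun_on_emp unfolding binary_structure_def
    by (intro exI[of _ M] exI[of _ R] exI[of _ emp]) auto
  then show ?thesis
    using assms(1,2) by (simp add: Struct_def is_struct_def subset_def fun_into_def ev_code)
qed

text \<open>The instance with \<open>A\<close> empty: there are no constants, so the interpretation
  \<open>I\<close> is the empty function, and \<open>U\<close> is empty because the language has
  only \<open>R\<close>.\<close>

lemma vopenka_binary:
  assumes "definable P" and proper: "\<not> (\<exists>w. \<forall>y. y \<in>\<^sub>m w \<longleftrightarrow> P y)"
    and struct: "\<And>x. P x \<Longrightarrow> \<exists>M R. x = quad M emp R emp \<and> binary_structure M R"
  shows "\<exists>M R N Q f. P (quad M emp R emp) \<and> P (quad N emp Q emp) \<and>
    quad M emp R emp \<noteq> quad N emp Q emp \<and> embedding f M R N Q"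
proof -
  obtain p e where p: "\<And>x. P x \<longleftrightarrow> sat (=) E (case_nat x e) p"
    using assms(1) unfolding definable_def by blast
  obtain k where k: "fv p \<subseteq> {..k}" using fv_bound by blast
  then have "closure k (vopenka p) \<in> EST \<union> VP" by (auto simp: VP_def)
  then have "sat (=) E u (closure k (vopenka p))" by (rule model)
  then have "ev (=) E u k e (vopenka p)" unfolding sat_closure ..
  then have vp: "ev (=) E u (Suc k) (e(k := emp)) (proper_class p \<^bold>\<and> (\<^bold>\<forall>x. appL p x \<^bold>\<longrightarrow> Struct k x) \<^bold>\<longrightarrow>
       (\<^bold>\<exists>q. \<^bold>\<exists>r. appL p q \<^bold>\<and> appL p r \<^bold>\<and> \<^bold>\<not> q \<^bold>= r \<^bold>\<and> (\<^bold>\<exists>f. elem_emb k f q r)))"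
    unfolding vopenka_def ev_all by (rule spec)
  have app: "ev (=) E v n \<rho> (appL p x) \<longleftrightarrow> P (\<rho> x)"
    if "k \<le> n" "x < n" "\<forall>i<k. \<rho> i = e i" for v n \<rho> x
    using ev_appL[OF k, of n x \<rho> e] that by (simp add: p)
  have "\<exists>y. P y \<and> \<not> y \<in>\<^sub>m w \<or> \<not> P y \<and> y \<in>\<^sub>m w" for w using proper by blast
  then have "ev (=) E u (Suc k) (e(k := emp)) (proper_class p)"
    by (simp add: proper_class_def ev_set app)
  moreover have "ev (=) E u (Suc k) (e(k := emp)) (\<^bold>\<forall>x. appL p x \<^bold>\<longrightarrow> Struct k x)"
    unfolding ev_all ev_imp
  proof (intro allI impI)
    fix x assume "ev (=) E u (Suc (Suc k)) (e(k := emp, Suc k := x)) (appL p (Suc k))"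
    then have "P x" by (simp add: app)
    then obtain M R where "x = quad M emp R emp" "binary_structure M R" using struct by blast
    then show "ev (=) E u (Suc (Suc k)) (e(k := emp, Suc k := x)) (Struct k (Suc k))"
      by (intro ev_Struct_I) simp_all
  qed
  ultimately obtain q r f where "P q" "P r" "q \<noteq> r" and
    emb: "ev (=) E u (Suc (Suc (Suc (Suc k))))
      (e(k := emp, Suc k := q, Suc (Suc k) := r, Suc (Suc (Suc k)) := f))
      (elem_emb k (Suc (Suc (Suc k))) (Suc k) (Suc (Suc k)))"
    using vp unfolding ev_imp ev_and by (auto simp: ev_ex ev_and ev_not ev_eq app)
  obtain M R where q: "q = quad M emp R emp" "binary_structure M R" using struct \<open>P q\<close> by blast
  obtain N Q where r: "r = quad N emp Q emp" using struct \<open>P r\<close> by blast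
  have "embedding f M R N Q"
    using ev_elem_emb_D[OF _ _ _ _ _ _ q(2) emb] by (simp add: q r)
  with \<open>P q\<close> \<open>P r\<close> \<open>q \<noteq> r\<close> show ?thesis unfolding q r by blast
qed

section \<open>Rigidity of looped paths\<close>

text \<open>The path \<open>0 \<rightarrow> 1 \<rightarrow> \<dots> \<rightarrow> n\<close>, with loops at both ends.\<close>

definition looped_path :: "'a \<Rightarrow> 'a \<Rightarrow> bool" where
  "looped_path n R \<longleftrightarrow> is_nat n \<and> n \<noteq> emp \<and>
     (\<forall>p. p \<in>\<^sub>m R \<longleftrightarrow> p = pr emp emp \<or> p = pr n n \<or> (\<exists>k. k \<in>\<^sub>m n \<and> p = pr k (suc k)))"

lemma looped_path_exists:
  assumes "is_nat n" "n \<noteq> emp"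
  shows "\<exists>R. looped_path n R"
proof -
  obtain S where "\<forall>p. p \<in>\<^sub>m S \<longleftrightarrow> (\<exists>k. k \<in>\<^sub>m n \<and> p = pr k (suc k))"
    using successor_graph_exists assms by blast
  then have "looped_path n (ins (pr emp emp) (ins (pr n n) S))"
    using assms by (simp add: looped_path_def)
  then show ?thesis ..
qed

lemma looped_path_mem:
  assumes "looped_path n R" "pr a b \<in>\<^sub>m R"
  shows "a \<in>\<^sub>m suc n" "b \<in>\<^sub>m suc n"
proof -
  have n: "is_nat n" "n \<noteq> emp" and
    "a = emp \<and> b = emp \<or> a = n \<and> b = n \<or> a \<in>\<^sub>m n \<and> b = suc a"
    using assms unfolding looped_path_def by auto
  then show "a \<in>\<^sub>m suc n" "b \<in>\<^sub>m suc n"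
    using emp_mem suc_mem_suc[of n a] by auto
qed

lemma looped_path_binary_structure:
  assumes "looped_path n R"
  shows "binary_structure (suc n) R"
proof -
  have n: "is_nat n" and R: "\<And>p. p \<in>\<^sub>m R \<longleftrightarrow>
      p = pr emp emp \<or> p = pr n n \<or> (\<exists>k. k \<in>\<^sub>m n \<and> p = pr k (suc k))"
    using assms unfolding looped_path_def by blast+
  obtain S where S: "\<forall>p. p \<in>\<^sub>m S \<longleftrightarrow> (\<exists>k. k \<in>\<^sub>m n \<and> p = pr (pr emp k) (suc k))"
    using successor_tuples_exist n by blast
  \<comment> \<open>The relation with its pairs recoded as tuples; the two loops are added to the
    coded successor pairs.\<close>
  let ?Y = "ins (pr (pr emp emp) emp) (ins (pr (pr emp n) n) S)"
  have "\<forall>x. x \<in>\<^sub>m ?Y \<longleftrightarrow> (\<exists>a b. pr a b \<in>\<^sub>m R \<and> x = pr (pr emp a) b)"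
    unfolding R pr_eq_iff by (auto simp: S)
  moreover have "\<exists>a. a \<in>\<^sub>m suc n \<and> (\<exists>b. b \<in>\<^sub>m suc n \<and> p = pr a b)" if p: "p \<in>\<^sub>m R" for p
  proof -
    obtain a b where "p = pr a b" using p unfolding R by blast
    with p looped_path_mem[OF assms] show ?thesis by blast
  qed
  ultimately show ?thesis unfolding binary_structure_def using suc_neq_emp by blast
qed

lemma looped_path_rigid:
  assumes R: "looped_path n R" and Q: "looped_path m Q" and emb: "embedding f (suc n) R (suc m) Q"
  shows "n = m"
proof -
  have n: "is_nat n" "n \<noteq> emp" and R_iff: "\<And>a b. pr a b \<in>\<^sub>m R \<longleftrightarrow>
      a = emp \<and> b = emp \<or> a = n \<and> b = n \<or> a \<in>\<^sub>m n \<and> b = suc a"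
    using R unfolding looped_path_def by auto
  have m: "is_nat m" and Q_iff: "\<And>a b. pr a b \<in>\<^sub>m Q \<longleftrightarrow>
      a = emp \<and> b = emp \<or> a = m \<and> b = m \<or> a \<in>\<^sub>m m \<and> b = suc a"
    using Q unfolding looped_path_def by auto
  have total: "\<exists>b. pr a b \<in>\<^sub>m f" if "a \<in>\<^sub>m suc n" for a
    using emb that unfolding embedding_def fun_on_def by blast
  have inj: "a = b" if "pr a c \<in>\<^sub>m f" "pr b c \<in>\<^sub>m f" for a b c
    using emb that unfolding embedding_def by blast
  have hom: "pr a' b' \<in>\<^sub>m Q" if "pr a b \<in>\<^sub>m R" "pr a a' \<in>\<^sub>m f" "pr b b' \<in>\<^sub>m f" for a b a' b'
    using emb that unfolding embedding_def by blast
  have m_suc: "suc x \<noteq> x" if "x \<in>\<^sub>m m" for x using nat_mem[OF m that] by simp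
  \<comment> \<open>A proper step of the path cannot go to a loop, because \<open>f\<close> is injective.\<close>
  have step: "a' \<in>\<^sub>m m \<and> b' = suc a'"
    if "a \<in>\<^sub>m n" "pr a a' \<in>\<^sub>m f" "pr (suc a) b' \<in>\<^sub>m f" for a a' b'
  proof -
    have "a' \<noteq> b'" using inj[of a a' "suc a"] that nat_mem[OF n(1) that(1)] by auto
    then show ?thesis using hom[of a "suc a" a' b'] that by (auto simp: R_iff Q_iff)
  qed
  have emp_n: "emp \<in>\<^sub>m n" using emp_mem n by blast
  \<comment> \<open>The image of \<open>emp\<close> carries a loop and lies below \<open>m\<close>,
    since a proper step leaves it. The only such loop is the one at \<open>emp\<close>.\<close>
  have f_emp: "pr emp emp \<in>\<^sub>m f"
  proof -
    obtain c where c: "pr emp c \<in>\<^sub>m f" using total emp_n by auto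
    obtain d where "pr (suc emp) d \<in>\<^sub>m f" using total suc_mem_suc n(1) emp_n by blast
    then have "c \<in>\<^sub>m m" using step emp_n c by blast
    moreover have "pr c c \<in>\<^sub>m Q" using hom[of emp emp] c by (simp add: R_iff)
    ultimately have "c = emp" using m_suc[of c] nat_irrefl[OF m] by (auto simp: Q_iff)
    with c show ?thesis by simp
  qed
  have "k \<in>\<^sub>m suc n \<longrightarrow> pr k k \<in>\<^sub>m f" if "is_nat k" for k
    using that
  \<comment> \<open>Levels \<open>0\<close> and \<open>1\<close> hold the parameters
    \<open>suc n\<close> and \<open>f\<close>, level \<open>2\<close> the induction
    variable.\<close>
  proof (rule nat_induct_ev[where n = 2 and \<rho> = "u(0 := suc n, 1 := f)" and F = "2 \<^bold>\<in> 0 \<^bold>\<longrightarrow> app 1 2 2"])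
    fix k assume k: "is_nat k" "k \<in>\<^sub>m suc n \<longrightarrow> pr k k \<in>\<^sub>m f"
    show "suc k \<in>\<^sub>m suc n \<longrightarrow> pr (suc k) (suc k) \<in>\<^sub>m f"
    proof
      assume "suc k \<in>\<^sub>m suc n"
      then have "k \<in>\<^sub>m n" using mem_if_suc_mem_suc n(1) by blast
      moreover obtain c where "pr (suc k) c \<in>\<^sub>m f" using total \<open>suc k \<in>\<^sub>m suc n\<close> by blast
      ultimately show "pr (suc k) (suc k) \<in>\<^sub>m f" using step[of k k c] k(2) by auto
    qed
  qed (use f_emp in \<open>simp_all add: ev_code\<close>)
  then have "pr n n \<in>\<^sub>m f" using n by simp
  then have "pr n n \<in>\<^sub>m Q" using hom[of n n n n] by (simp add: R_iff)
  then show "n = m" using n m_suc[of n] by (auto simp: Q_iff)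
qed

section \<open>Recovering the natural numbers from the class of looped paths\<close>

text \<open>Two unions strip one layer of Kuratowski pairs, since the union of a pair has exactly
  its two components as elements.\<close>

lemma mem_un_un: "z \<in>\<^sub>m un (un w) \<longleftrightarrow> (\<exists>p. p \<in>\<^sub>m w \<and> z \<in>\<^sub>m un p)"
  by auto

lemma mem_un_pr: "z \<in>\<^sub>m un (pr a b) \<longleftrightarrow> z = a \<or> z = b"
  by (auto simp: pr_def)

text \<open>Taking unions seven times unwinds the Kuratowski quadruples down to the elements of
  their universes.\<close>

lemma omega_from_looped_paths:
  assumes w: "\<And>q. q \<in>\<^sub>m w \<longleftrightarrow> (\<exists>n R. looped_path n R \<and> q = quad (suc n) emp R emp)"
  shows "x \<in>\<^sub>m un (un (un (un (un (un (un w)))))) \<longleftrightarrow> is_nat x"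
proof -
  let ?w1 = "un (un w)" and ?w2 = "un (un (un (un w)))" and ?w3 = "un (un (un (un (un (un w)))))"
  have w1: "z \<in>\<^sub>m ?w1 \<longleftrightarrow> (\<exists>n R. looped_path n R \<and> (z = pr (pr (suc n) emp) R \<or> z = emp))" for z
  proof -
    have "z \<in>\<^sub>m ?w1 \<longleftrightarrow> (\<exists>n R. looped_path n R \<and> z \<in>\<^sub>m un (quad (suc n) emp R emp))"
      unfolding mem_un_un[of z] w by blast
    then show ?thesis unfolding quad_def mem_un_pr .
  qed
  have w2: "z \<in>\<^sub>m ?w2 \<longleftrightarrow> (\<exists>n R. looped_path n R \<and> (z = pr (suc n) emp \<or> z = R))" for z
  proof -
    have "\<not> z \<in>\<^sub>m un emp" by simp
    then have "z \<in>\<^sub>m ?w2 \<longleftrightarrow> (\<exists>n R. looped_path n R \<and> z \<in>\<^sub>m un (pr (pr (suc n) emp) R))"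
      unfolding mem_un_un[of z] w1 by blast
    then show ?thesis unfolding mem_un_pr .
  qed
  have w3: "z \<in>\<^sub>m ?w3 \<longleftrightarrow> (\<exists>n R. looped_path n R \<and> (z = suc n \<or> z = emp \<or> z \<in>\<^sub>m un R))" for z
  proof -
    have "z \<in>\<^sub>m ?w3 \<longleftrightarrow>
        (\<exists>n R. looped_path n R \<and> (z \<in>\<^sub>m un (pr (suc n) emp) \<or> z \<in>\<^sub>m un R))"
      unfolding mem_un_un[of z] w2 by blast
    then show ?thesis unfolding mem_un_pr disj_assoc .
  qed
  show ?thesis
  proof
    assume "x \<in>\<^sub>m un ?w3"
    then obtain z n R where R: "looped_path n R" and z: "z = suc n \<or> z = emp \<or> z \<in>\<^sub>m un R" and "x \<in>\<^sub>m z"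
      unfolding mem_un[of x] w3 by blast
    have n: "is_nat (suc n)" using R by (simp add: looped_path_def)
    \<comment> \<open>The unions take the relation apart as well, but this contributes only vertices
      of the path.\<close>
    have "x \<in>\<^sub>m suc n" if "z \<in>\<^sub>m un R"
    proof -
      have "x \<in>\<^sub>m un (un R)" using that \<open>x \<in>\<^sub>m z\<close> mem_un by blast
      then obtain p where p: "p \<in>\<^sub>m R" "x \<in>\<^sub>m un p" unfolding mem_un_un by blast
      then obtain a b where "p = pr a b" using R unfolding looped_path_def by blast
      with p have "pr a b \<in>\<^sub>m R" "x = a \<or> x = b" by (simp_all add: mem_un_pr del: mem_un)
      then show ?thesis using looped_path_mem[OF R] by blast
    qed
    with z \<open>x \<in>\<^sub>m z\<close> have "x \<in>\<^sub>m suc n" by auto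
    with n nat_mem show "is_nat x" by blast
  next
    assume "is_nat x"
    \<comment> \<open>The path ends at \<open>suc x\<close> rather than \<open>x\<close>, because
      its end must differ from \<open>emp\<close>.\<close>
    then obtain R where R: "looped_path (suc x) R" using looped_path_exists by fastforce
    have "x \<in>\<^sub>m suc (suc x)" by simp
    moreover have "suc (suc x) \<in>\<^sub>m ?w3" unfolding w3 using R by blast
    ultimately show "x \<in>\<^sub>m un ?w3" unfolding mem_un[of x] by blast
  qed
qed

theorem omega_exists: "\<exists>w. \<forall>x. x \<in>\<^sub>m w \<longleftrightarrow> is_nat x"
proof (rule ccontr)
  assume no_omega: "\<not> ?thesis"
  define P where "P q \<longleftrightarrow> (\<exists>n R. looped_path n R \<and> q = quad (suc n) emp R emp)" for q
  \<comment> \<open>Vopenka's principle is a scheme, so the class of looped paths needs an explicit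
    defining formula, with \<open>q\<close> at level \<open>0\<close>.\<close>
  have "P q \<longleftrightarrow> ev (=) E u (Suc 0) (u(0 := q)) (\<^bold>\<exists>n. \<^bold>\<exists>R. \<^bold>\<exists>M. \<^bold>\<exists>e.
      is_suc M n \<^bold>\<and> is_empty e \<^bold>\<and> Nat n \<^bold>\<and> \<^bold>\<not> is_empty n \<^bold>\<and> is_quad 0 M e R e \<^bold>\<and>
      (\<^bold>\<forall>p. p \<^bold>\<in> R \<^bold>\<longleftrightarrow> is_pair p e e \<^bold>\<or> is_pair p n n \<^bold>\<or>
        bexL n (\<lambda>k. \<^bold>\<exists>j. is_suc j k \<^bold>\<and> is_pair p k j)))" for q
    by (auto simp: P_def looped_path_def ev_code)
  then have "definable P" using definable_ev[of u 0 u] by presburger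
  moreover have "\<not> (\<exists>w. \<forall>q. q \<in>\<^sub>m w \<longleftrightarrow> P q)"
    using no_omega omega_from_looped_paths unfolding P_def by blast
  moreover have "\<exists>M R. q = quad M emp R emp \<and> binary_structure M R" if "P q" for q
    using that looped_path_binary_structure unfolding P_def by blast
  ultimately obtain M R N Q f where PQ: "P (quad M emp R emp)" "P (quad N emp Q emp)"
    and neq: "quad M emp R emp \<noteq> quad N emp Q emp" and emb: "embedding f M R N Q"
    using vopenka_binary[of P] by blast
  obtain n m where n: "looped_path n R" "M = suc n" and m: "looped_path m Q" "N = suc m"
    using PQ unfolding P_def quad_def pr_eq_iff by blast
  have "n = m" using looped_path_rigid n m emb by blast
  \<comment> \<open>The end point determines the relation by extensionality, so distinct structures
    have distinct end points.\<close>
  moreover from this have "R = Q" using n m unfolding looped_path_def ext_iff[of R] by simp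
  ultimately show False using neq n m by simp
qed

lemma sat_omega_is_set: "sat (=) E u (omega_is_set 0)"
  unfolding sat_sentence[where \<rho> = u]
  using omega_exists by (simp add: omega_is_set_def ev_set)

lemma sat_ax_infinity: "sat (=) E u (ax_infinity 0)"
proof -
  obtain w where "\<forall>x. x \<in>\<^sub>m w \<longleftrightarrow> is_nat x" using omega_exists by blast
  then have "emp \<in>\<^sub>m w \<and> (\<forall>x. x \<in>\<^sub>m w \<longrightarrow> suc x \<in>\<^sub>m w)" by simp
  then show ?thesis
    unfolding sat_sentence[where \<rho> = u] by (auto simp: ax_infinity_def ev_set)
qed

end

theorem theorem2p12:
  shows "EST \<union> VP \<turnstile> omega_is_set 0 \<and> EST \<union> VP \<turnstile> ax_infinity 0"
proof -
  \<comment> \<open>Completeness asks only for models on \<open>nat\<close>, each of which is an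
    instance of \<open>set_model\<close>.\<close>
  have "set_model E v" if "\<And>q. q \<in> EST \<union> VP \<Longrightarrow> sat (=) E v q"
    for E :: "nat \<Rightarrow> nat \<Rightarrow> bool" and v
    using that by unfold_locales
  then show ?thesis
    by (intro conjI EST_completeness) (auto intro: set_model.sat_omega_is_set set_model.sat_ax_infinity)
qed

end
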